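(* Let $G$ be a group, $Y\subseteq G$ a finite set containing at least two elements which generates $G$ as a semigroup, $F:Y\to\mathbb R$ a function, and $\beta\in\mathbb R$. Assume that $G$ is nilpotent and that the abelianization $G/[G,G]$ is trivial or a finite group. Then there is a $\beta$-KMS measure for $\alpha^F$ on $Y^{\mathbb N}$ if and only if $$\sum_{s\in Y}e^{-\beta F(s)}=1.$$ When it exists, the $\beta$-KMS measure is unique and it is the Bernoulli measure corresponding to the probability vector $p_s=e^{-\beta F(s)}$, $s\in Y$.
   Context: Words: $Y^0=\{\emptyset\}$; for $t=(t_1,\dots,t_k)\in Y^k$ put $\overline t=t_1t_2\cdots t_k\in G$ and $F(t)=\sum_{j=1}^k F(t_j)$; $\overline{\emptyset}=e_0$ (the neutral element of $G$), $F(\emptyset)=0$. $tY^{\mathbb N}\subseteq Y^{\mathbb N}$ is the cylinder set of infinite words starting with $t$, and $\emptyset Y^{\mathbb N}=Y^{\mathbb N}$. $O_Y$ is the Cuntz algebra generated by isometries $V_s$, $s\in Y$, with $\sum_{s\in Y}V_sV_s^*=1$; $V_t=V_{t_1}\cdots V_{t_k}$, $V_\emptyset=1$. $O_Y(G)\subseteq O_Y$ is the $C^*$-subalgebra which is the closed linear span of the elements $V_tV_u^*$ with $\overline t=\overline u$. $\alpha^F$ is the one-parameter group of automorphisms of $O_Y$ (restricted to $O_Y(G)$) with $\alpha^F_r(V_wV_u^* )=e^{ir(F(w)-F(u))}V_wV_u^*$, $r\in\mathbb R$. A state $\omega$ on $O_Y(G)$ is a $\beta$-KMS state for $\alpha^F$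 if there is a dense $\alpha^F$-invariant $*$-subalgebra $\mathcal A$ of $O_Y(G)$ consisting of analytic elements for $\alpha^F$ with $\omega(ab)=\omega(b\,\alpha^F_{i\beta}(a))$ for all $a,b\in\mathcal A$. The elements $V_tV_t^*$ generate a copy of $C(Y^{\mathbb N})$ in $O_Y(G)$ ($V_tV_t^*$ being the indicator function of $tY^{\mathbb N}$), and $E:O_Y\to C(Y^{\mathbb N})$ is the conditional expectation with $E(V_tV_u^* )=V_tV_t^*$ if $t=u$ and $0$ otherwise. A Borel probability measure $m$ on $Y^{\mathbb N}$ is a $\beta$-KMS measure for $\alpha^F$ when the state $a\mapsto\int_{Y^{\mathbb N}}E(a)\,\mathrm dm$ on $O_Y(G)$ is a $\beta$-KMS state for $\alpha^F$. The Bernoulli measure corresponding to a probability vector $(p_s)_{s\in Y}$ is the infinite product measure, $m(tY^{\mathbb N})=\prod_{i=1}^kp_{t_i}$ for $t\in Y^k$. *)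

theory Defs
  imports
    "HOL-Analysis.Analysis"
    "HOL-Probability.Probability_Measure"
    "HOL-Algebra.Coset"
    "HOL-Algebra.Generated_Groups"
    "HOL-Algebra.Elementary_Groups"
begin

section \<open>Groups\<close>

definition word_prod :: "('g, 'b) monoid_scheme \<Rightarrow> 'g list \<Rightarrow> 'g" where
  "word_prod G t = foldr (\<lambda>s g. s \<otimes>\<^bsub>G\<^esub> g) t \<one>\<^bsub>G\<^esub>"

text \<open>Generation as a semigroup: only non-empty words are used, and no inverses.\<close>

definition semigroup_generates :: "('g, 'b) monoid_scheme \<Rightarrow> 'g set \<Rightarrow> bool" where
  "semigroup_generates G Y \<longleftrightarrow> carrier G = {word_prod G t | t. t \<in> lists Y \<and> t \<noteq> []}"

primrec lower_central_series :: "('g, 'b) monoid_scheme \<Rightarrow> nat \<Rightarrow> 'g set" where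
  "lower_central_series G 0 = carrier G"
| "lower_central_series G (Suc n) = generate G
     (\<Union>x\<in>lower_central_series G n. \<Union>y\<in>carrier G.
        {x \<otimes>\<^bsub>G\<^esub> y \<otimes>\<^bsub>G\<^esub> (inv\<^bsub>G\<^esub> x) \<otimes>\<^bsub>G\<^esub> (inv\<^bsub>G\<^esub> y)})"

definition nilpotent_group :: "('g, 'b) monoid_scheme \<Rightarrow> bool" where
  "nilpotent_group G \<longleftrightarrow> group G \<and> (\<exists>n. lower_central_series G n = {\<one>\<^bsub>G\<^esub>})"

definition abelianization :: "('g, 'b) monoid_scheme \<Rightarrow> 'g set monoid" where
  "abelianization G = G Mod derived G (carrier G)"


section \<open>Unital C*-algebras\<close>

class cstar_algebra = real_normed_algebra_1 + banach +
  fixes scaleC :: "complex \<Rightarrow> 'a \<Rightarrow> 'a"  (infixr \<open>*\<^sub>C\<close> 75)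
    and adj :: "'a \<Rightarrow> 'a"
  assumes scaleC_add_right: "c *\<^sub>C (a + b) = c *\<^sub>C a + c *\<^sub>C b"
    and scaleC_add_left: "(c + d) *\<^sub>C a = c *\<^sub>C a + d *\<^sub>C a"
    and scaleC_scaleC: "c *\<^sub>C d *\<^sub>C a = (c * d) *\<^sub>C a"
    and scaleR_scaleC: "r *\<^sub>R a = complex_of_real r *\<^sub>C a"
    and norm_scaleC: "norm (c *\<^sub>C a) = cmod c * norm a"
    and mult_scaleC_left: "(c *\<^sub>C a) * b = c *\<^sub>C (a * b)"
    and mult_scaleC_right: "a * (c *\<^sub>C b) = c *\<^sub>C (a * b)"
    and adj_adj: "adj (adj a) = a"
    and adj_add: "adj (a + b) = adj a + adj b"
    and adj_scaleC: "adj (c *\<^sub>C a) = cnj c *\<^sub>C adj a"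
    and adj_mult: "adj (a * b) = adj b * adj a"
    and cstar_identity: "norm (adj a * a) = (norm a)\<^sup>2"

global_interpretation complex_vector: vector_space "scaleC :: complex \<Rightarrow> 'a \<Rightarrow> 'a::cstar_algebra"
  defines cspan = complex_vector.span
    and csubspace = complex_vector.subspace
proof
  fix a :: 'a
  show "1 *\<^sub>C a = a"
    using scaleR_scaleC[of 1 a] by simp
qed (simp_all add: scaleC_add_right scaleC_add_left scaleC_scaleC)

definition star_subalgebra :: "'a::cstar_algebra set \<Rightarrow> bool" where
  "star_subalgebra A \<longleftrightarrow>
     csubspace A \<and> (\<forall>a\<in>A. \<forall>b\<in>A. a * b \<in> A) \<and> (\<forall>a\<in>A. adj a \<in> A)"

definition generated_cstar_subalgebra :: "'a::cstar_algebra set \<Rightarrow> 'a set" where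
  "generated_cstar_subalgebra S = \<Inter>{A. star_subalgebra A \<and> closed A \<and> S \<subseteq> A}"

definition clinear_on_set :: "'a::cstar_algebra set \<Rightarrow> ('a \<Rightarrow> 'b::cstar_algebra) \<Rightarrow> bool" where
  "clinear_on_set A f \<longleftrightarrow>
     (\<forall>a\<in>A. \<forall>b\<in>A. f (a + b) = f a + f b) \<and> (\<forall>c. \<forall>a\<in>A. f (c *\<^sub>C a) = c *\<^sub>C f a)"

text \<open>The norm clause is redundant for C*-subalgebras: a bijective *-homomorphism between
  C*-algebras is isometric.\<close>

definition star_automorphism :: "'a::cstar_algebra set \<Rightarrow> ('a \<Rightarrow> 'a) \<Rightarrow> bool" where
  "star_automorphism A f \<longleftrightarrow> bij_betw f A A \<and> clinear_on_set A f
     \<and> (\<forall>a\<in>A. \<forall>b\<in>A. f (a * b) = f a * f b)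
     \<and> (\<forall>a\<in>A. f (adj a) = adj (f a))
     \<and> (\<forall>a\<in>A. norm (f a) = norm a)"

definition one_parameter_group :: "'a::cstar_algebra set \<Rightarrow> (real \<Rightarrow> 'a \<Rightarrow> 'a) \<Rightarrow> bool" where
  "one_parameter_group A \<alpha> \<longleftrightarrow> (\<forall>r. star_automorphism A (\<alpha> r))
     \<and> (\<forall>a\<in>A. \<alpha> 0 a = a)
     \<and> (\<forall>r s. \<forall>a\<in>A. \<alpha> (r + s) a = \<alpha> r (\<alpha> s a))
     \<and> (\<forall>a\<in>A. continuous_on UNIV (\<lambda>r. \<alpha> r a))"

text \<open>A positive contractive idempotent \<open>D\<close>-bimodule map of \<open>A\<close> onto the C*-subalgebra \<open>D\<close>.
  An element of \<open>D\<close> is positive iff it is of the form \<open>d* d\<close> with \<open>d \<in> D\<close>.\<close>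

definition conditional_expectation ::
    "'a::cstar_algebra set \<Rightarrow> 'a set \<Rightarrow> ('a \<Rightarrow> 'a) \<Rightarrow> bool" where
  "conditional_expectation A D E \<longleftrightarrow> clinear_on_set A E
     \<and> (\<forall>a\<in>A. E a \<in> D) \<and> (\<forall>d\<in>D. E d = d)
     \<and> (\<forall>a\<in>A. norm (E a) \<le> norm a)
     \<and> (\<forall>a\<in>A. \<exists>d\<in>D. E (adj a * a) = adj d * d)
     \<and> (\<forall>a\<in>A. \<forall>d\<in>D. E (d * a) = d * E a \<and> E (a * d) = E a * d)"

definition state_on :: "'a::cstar_algebra set \<Rightarrow> ('a \<Rightarrow> complex) \<Rightarrow> bool" where
  "state_on A \<omega> \<longleftrightarrow>
     (\<forall>a\<in>A. \<forall>b\<in>A. \<omega> (a + b) = \<omega> a + \<omega> b) \<and> (\<forall>c. \<forall>a\<in>A. \<omega> (c *\<^sub>C a) = c * \<omega> a)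
     \<and> (\<forall>a\<in>A. \<omega> (adj a * a) \<in> \<real>\<^sub>\<ge>\<^sub>0) \<and> \<omega> 1 = 1"


section \<open>KMS states\<close>

text \<open>\<open>f\<close> is the entire extension \<open>z \<mapsto> \<alpha>\<^sub>z(a)\<close> of the orbit of \<open>a\<close>;
  \<open>a\<close> is analytic for \<open>\<alpha>\<close> iff such an \<open>f\<close> exists, and \<open>f\<close> is then unique.\<close>

definition entire_orbit ::
    "'a::cstar_algebra set \<Rightarrow> (real \<Rightarrow> 'a \<Rightarrow> 'a) \<Rightarrow> 'a \<Rightarrow> (complex \<Rightarrow> 'a) \<Rightarrow> bool" where
  "entire_orbit A \<alpha> a f \<longleftrightarrow> range f \<subseteq> A
     \<and> (\<forall>z. \<exists>d. (f has_derivative (\<lambda>h. h *\<^sub>C d)) (at z))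
     \<and> (\<forall>r. f (complex_of_real r) = \<alpha> r a)"

definition kms_state ::
    "'a::cstar_algebra set \<Rightarrow> (real \<Rightarrow> 'a \<Rightarrow> 'a) \<Rightarrow> real \<Rightarrow> ('a \<Rightarrow> complex) \<Rightarrow> bool" where
  "kms_state A \<alpha> \<beta> \<omega> \<longleftrightarrow> state_on A \<omega> \<and>
     (\<exists>\<A>. star_subalgebra \<A> \<and> \<A> \<subseteq> A \<and> A \<subseteq> closure \<A> \<and> (\<forall>r. \<alpha> r ` \<A> \<subseteq> \<A>)
        \<and> (\<forall>a\<in>\<A>. \<exists>f. entire_orbit A \<alpha> a f
              \<and> (\<forall>b\<in>\<A>. \<omega> (a * b) = \<omega> (b * f (\<i> * complex_of_real \<beta>)))))"


section \<open>The Cuntz algebra of \<open>Y\<close> and its subalgebras\<close>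

definition cuntz_family :: "'g set \<Rightarrow> ('g \<Rightarrow> 'a::cstar_algebra) \<Rightarrow> bool" where
  "cuntz_family Y V \<longleftrightarrow> (\<forall>s\<in>Y. adj (V s) * V s = 1) \<and> (\<Sum>s\<in>Y. V s * adj (V s)) = 1"

text \<open>By Cuntz's uniqueness theorem, for finite \<open>Y\<close> with at least two elements, any realisation
  \<open>V\<close> of the relations in any unital C*-algebra generates the same algebra up to isomorphism.\<close>

definition cuntz_algebra :: "'g set \<Rightarrow> ('g \<Rightarrow> 'a::cstar_algebra) \<Rightarrow> 'a set" where
  "cuntz_algebra Y V = generated_cstar_subalgebra (V ` Y)"

definition word_isometry :: "('g \<Rightarrow> 'a::cstar_algebra) \<Rightarrow> 'g list \<Rightarrow> 'a" where
  "word_isometry V t = prod_list (map V t)"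

definition word_sum :: "('g \<Rightarrow> real) \<Rightarrow> 'g list \<Rightarrow> real" where
  "word_sum F t = sum_list (map F t)"

definition cuntz_group_algebra ::
    "('g, 'b) monoid_scheme \<Rightarrow> 'g set \<Rightarrow> ('g \<Rightarrow> 'a::cstar_algebra) \<Rightarrow> 'a set" where
  "cuntz_group_algebra G Y V = closure (cspan
     {word_isometry V t * adj (word_isometry V u) | t u.
        t \<in> lists Y \<and> u \<in> lists Y \<and> word_prod G t = word_prod G u})"

definition cuntz_diagonal :: "'g set \<Rightarrow> ('g \<Rightarrow> 'a::cstar_algebra) \<Rightarrow> 'a set" where
  "cuntz_diagonal Y V = generated_cstar_subalgebra
     {word_isometry V t * adj (word_isometry V t) | t. t \<in> lists Y}"

text \<open>Linearity and continuity of the maps determine \<open>\<alpha>\<close> on \<open>cuntz_algebra Y V\<close>, and likewise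
  the maps \<open>E\<close> and \<open>\<Phi>\<close> below on their domains; existence of \<open>\<alpha>\<close> is the universal property of
  the Cuntz algebra. Nothing is required of the values outside these domains.\<close>

definition cuntz_dynamics ::
    "'g set \<Rightarrow> ('g \<Rightarrow> 'a::cstar_algebra) \<Rightarrow> ('g \<Rightarrow> real) \<Rightarrow> (real \<Rightarrow> 'a \<Rightarrow> 'a) \<Rightarrow> bool" where
  "cuntz_dynamics Y V F \<alpha> \<longleftrightarrow> one_parameter_group (cuntz_algebra Y V) \<alpha>
     \<and> (\<forall>r. \<forall>w\<in>lists Y. \<forall>u\<in>lists Y.
          \<alpha> r (word_isometry V w * adj (word_isometry V u))
          = exp (\<i> * complex_of_real (r * (word_sum F w - word_sum F u)))
              *\<^sub>C (word_isometry V w * adj (word_isometry V u)))"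

definition cuntz_expectation ::
    "'g set \<Rightarrow> ('g \<Rightarrow> 'a::cstar_algebra) \<Rightarrow> ('a \<Rightarrow> 'a) \<Rightarrow> bool" where
  "cuntz_expectation Y V E \<longleftrightarrow>
     conditional_expectation (cuntz_algebra Y V) (cuntz_diagonal Y V) E
     \<and> (\<forall>t\<in>lists Y. \<forall>u\<in>lists Y. E (word_isometry V t * adj (word_isometry V u))
          = (if t = u then word_isometry V t * adj (word_isometry V t) else 0))"


section \<open>Infinite words and measures\<close>

definition word_topology :: "'g set \<Rightarrow> (nat \<Rightarrow> 'g) topology" where
  "word_topology Y = product_topology (\<lambda>_. discrete_topology Y) UNIV"

definition cylinder :: "'g set \<Rightarrow> 'g list \<Rightarrow> (nat \<Rightarrow> 'g) set" where
  "cylinder Y t = {x \<in> topspace (word_topology Y). \<forall>i<length t. x i = t ! i}"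

definition word_borel :: "'g set \<Rightarrow> (nat \<Rightarrow> 'g) measure" where
  "word_borel Y = sigma (topspace (word_topology Y)) {U. openin (word_topology Y) U}"

text \<open>\<open>\<Phi>\<close> is the *-isomorphism of the diagonal onto the continuous functions on \<open>Y\<^sup>\<nat>\<close>,
  sending \<open>V\<^sub>t V\<^sub>t*\<close> to the indicator function of \<open>tY\<^sup>\<nat>\<close>. It is isometric for the supremum
  norm, hence injective. Functions are only considered on \<open>Y\<^sup>\<nat>\<close>.\<close>

definition diagonal_iso ::
    "'g set \<Rightarrow> ('g \<Rightarrow> 'a::cstar_algebra) \<Rightarrow> ('a \<Rightarrow> (nat \<Rightarrow> 'g) \<Rightarrow> complex) \<Rightarrow> bool" where
  "diagonal_iso Y V \<Phi> \<longleftrightarrow>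
     (let D = cuntz_diagonal Y V; X = topspace (word_topology Y) in
       (\<forall>a\<in>D. continuous_map (word_topology Y) euclidean (\<Phi> a))
     \<and> (\<forall>f. continuous_map (word_topology Y) euclidean f \<longrightarrow> (\<exists>a\<in>D. \<forall>x\<in>X. \<Phi> a x = f x))
     \<and> (\<forall>a\<in>D. \<forall>b\<in>D. \<forall>x\<in>X. \<Phi> (a + b) x = \<Phi> a x + \<Phi> b x)
     \<and> (\<forall>c. \<forall>a\<in>D. \<forall>x\<in>X. \<Phi> (c *\<^sub>C a) x = c * \<Phi> a x)
     \<and> (\<forall>a\<in>D. \<forall>b\<in>D. \<forall>x\<in>X. \<Phi> (a * b) x = \<Phi> a x * \<Phi> b x)
     \<and> (\<forall>a\<in>D. \<forall>x\<in>X. \<Phi> (adj a) x = cnj (\<Phi> a x))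
     \<and> (\<forall>a\<in>D. norm a = (SUP x\<in>X. cmod (\<Phi> a x)))
     \<and> (\<forall>t\<in>lists Y. \<forall>x\<in>X. \<Phi> (word_isometry V t * adj (word_isometry V t)) x
          = indicator (cylinder Y t) x))"

definition kms_measure ::
    "('g, 'b) monoid_scheme \<Rightarrow> 'g set \<Rightarrow> ('g \<Rightarrow> 'a::cstar_algebra) \<Rightarrow> (real \<Rightarrow> 'a \<Rightarrow> 'a)
     \<Rightarrow> ('a \<Rightarrow> 'a) \<Rightarrow> ('a \<Rightarrow> (nat \<Rightarrow> 'g) \<Rightarrow> complex) \<Rightarrow> real \<Rightarrow> (nat \<Rightarrow> 'g) measure \<Rightarrow> bool" where
  "kms_measure G Y V \<alpha> E \<Phi> \<beta> m \<longleftrightarrow> prob_space m \<and> sets m = sets (word_borel Y)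
     \<and> kms_state (cuntz_group_algebra G Y V) \<alpha> \<beta> (\<lambda>a. \<integral>x. \<Phi> (E a) x \<partial>m)"

definition bernoulli_measure :: "'g set \<Rightarrow> ('g \<Rightarrow> real) \<Rightarrow> (nat \<Rightarrow> 'g) measure" where
  "bernoulli_measure Y p = (\<Pi>\<^sub>M i\<in>UNIV. point_measure Y (\<lambda>s. ennreal (p s)))"

end

theory Submission
  imports Defs
    "HOL-Complex_Analysis.Conformal_Mappings"
    "HOL-Probability.Infinite_Product_Measure"
    "HOL-Library.Sublist"
begin

text \<open>Let \<open>m\<close> be a KMS measure. The KMS condition for \<open>V\<^sub>tV\<^sub>u*\<close> and \<open>V\<^sub>uV\<^sub>t*\<close> says that
  \<open>exp (\<beta> F(t)) m(tY\<^sup>\<nat>)\<close> depends only on the product of \<open>t\<close> in \<open>G\<close>, and additivity of \<open>m\<close> makes the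
  resulting function \<open>\<psi>\<close> on \<open>G\<close> harmonic: \<open>\<psi>(g) = \<Sum>\<^sub>s exp (-\<beta> F(s)) \<psi>(gs)\<close>. A nilpotent group with finite
  abelianization is finite, so \<open>\<psi>\<close> can be summed over \<open>G\<close> and attains its maximum; hence the weights sum
  to 1 and \<open>\<psi>\<close> is constant, which says that \<open>m\<close> is the Bernoulli measure. The converse is a
  computation on the products \<open>V\<^sub>tV\<^sub>u*V\<^sub>wV\<^sub>x*\<close>.\<close>

section \<open>Nilpotent groups with finite abelianization\<close>

text \<open>A KMS state comes with its identity only on some dense invariant subalgebra, and
  \<open>V_t V_u*\<close> need not belong to it. Approximation alone does not help: \<alpha> is
  isometric at real times only, so when a' tends to a nothing is known about the limit of
  \<open>\<alpha>_{i\<beta>}(a')\<close>. The identity is therefore carried over to eigenvectors of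
  \<alpha> by comparing the two edges of a strip: on the far edge the KMS condition turns the value
  at \<open>x + i\<beta>\<close> into one at the real time x, which does depend continuously on a'.
  In the converse direction the subalgebra may be chosen, and the span of the
  \<open>V_t V_u*\<close> with equal products serves.

  Finiteness of G is reached along the lower central series \<open>L\<close>. Each
  \<open>G Mod L (n + 1)\<close> is a central extension of \<open>G Mod L n\<close>, and a central
  subgroup of finite index that is generated by commutators is finite, an elementary relative of
  Schur's theorem on central subgroups of finite index.\<close>

lemma (in group) finite_generate_central_torsion:
  assumes "finite S" "S \<subseteq> carrier G"
    and "\<And>s x. s \<in> S \<Longrightarrow> x \<in> carrier G \<Longrightarrow> s \<otimes> x = x \<otimes> s"
    and "\<And>s. s \<in> S \<Longrightarrow> \<exists>k>0::nat. s [^] k = \<one>"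
  shows "finite (generate G S)"
  using assms
proof (induction S rule: finite_induct)
  case empty
  then show ?case by (simp add: generate_empty)
next
  case (insert a S)
  have IH: "finite (generate G S)"
    using insert.prems by (intro insert.IH) auto
  have a: "a \<in> carrier G" and S: "S \<subseteq> carrier G"
    using insert.prems by auto
  obtain k :: nat where k: "k > 0" "a [^] k = \<one>"
    using insert.prems(3)[of a] by auto
  \<comment> \<open>Since a is central with \<open>a^k = 1\<close>, the k powers of a times the old
    subgroup already form a set closed under all rules of \<open>generate\<close>; the inverse of a
    is \<open>a^(k-1)\<close>. So adjoining a enlarges the subgroup at most k-fold.\<close>
  define R where "R = (\<lambda>(i, g). a [^] i \<otimes> g) ` ({..<k} \<times> generate G S)"
  have gS: "generate G S \<subseteq> carrier G"
    using generate_incl[OF S] .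
  have red: "a [^] i = a [^] (i mod k)" for i :: nat
  proof -
    have "a [^] i = a [^] (k * (i div k) + i mod k)" by simp
    also have "\<dots> = (a [^] k) [^] (i div k) \<otimes> a [^] (i mod k)"
      using a by (simp add: nat_pow_mult nat_pow_pow)
    finally show ?thesis using a k by simp
  qed
  have R: "a [^] i \<otimes> g \<in> R" if "g \<in> generate G S" for i :: nat and g
  proof -
    have "a [^] i \<otimes> g = (\<lambda>(i, g). a [^] i \<otimes> g) (i mod k, g)"
      using red[of i] by simp
    moreover have "(i mod k, g) \<in> {..<k} \<times> generate G S" using that k by simp
    ultimately show ?thesis unfolding R_def by (rule image_eqI)
  qed
  have RE: "\<exists>(i::nat) g. x = a [^] i \<otimes> g \<and> g \<in> generate G S" if "x \<in> R" for x
    using that unfolding R_def by force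
  have apow: "a [^] i \<otimes> x = x \<otimes> a [^] i" if "x \<in> carrier G" for i :: nat and x
    using that a insert.prems(2)[of a x] by (simp add: group_commutes_pow)
  have "x \<in> R" if "x \<in> generate G (insert a S)" for x
    using that
  proof (induction rule: generate.induct)
    case one
    show ?case using R[of \<one> 0] generate.one by auto
  next
    case (incl h)
    then show ?case
    proof
      assume "h = a"
      then show ?thesis using R[of \<one> 1] generate.one a by auto
    next
      assume "h \<in> S"
      then show ?thesis using R[of h 0] generate.incl S by (metis l_one nat_pow_0 subset_iff)
    qed
  next
    case (inv h)
    then show ?case
    proof
      assume h: "h = a"
      have "a [^] (k - 1) \<otimes> a = \<one>"
        using k by (metis Suc_diff_1 nat_pow_Suc)
      then have "inv a = a [^] (k - 1)"
        using a by (simp add: inv_equality)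
      then show ?thesis using h R[of \<one> "k - 1"] generate.one a by auto
    next
      assume "h \<in> S"
      then show ?thesis using R[of "inv h" 0] generate.inv[of h S] S
        by (metis inv_closed l_one nat_pow_0 subset_iff)
    qed
  next
    case (eng x y)
    obtain i :: nat and g where x: "x = a [^] i \<otimes> g" "g \<in> generate G S"
      using RE[OF eng(3)] by blast
    obtain j :: nat and h where y: "y = a [^] j \<otimes> h" "h \<in> generate G S"
      using RE[OF eng(4)] by blast
    have gh: "g \<in> carrier G" "h \<in> carrier G" using x y gS by auto
    have "x \<otimes> y = a [^] i \<otimes> (g \<otimes> a [^] j) \<otimes> h"
      using x y gh a by (simp add: m_assoc)
    also have "\<dots> = a [^] i \<otimes> (a [^] j \<otimes> g) \<otimes> h"
      using apow[OF gh(1), of j] by simp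
    also have "\<dots> = (a [^] i \<otimes> a [^] j) \<otimes> (g \<otimes> h)"
      using gh a by (simp add: m_assoc)
    also have "\<dots> = a [^] (i + j) \<otimes> (g \<otimes> h)"
      using a by (simp add: nat_pow_mult)
    finally show ?case using R[OF generate.eng[OF x(2) y(2)]] by simp
  qed
  moreover have "finite R"
    unfolding R_def by (intro finite_imageI finite_cartesian_product IH finite_lessThan)
  ultimately show ?case
    by (meson finite_subset subsetI)
qed

text \<open>Commutators depend only on the two cosets of a central subgroup \<open>Z\<close>, so finite index
  leaves finitely many of them; a power of every element lies in \<open>Z\<close>, so those lying in \<open>Z\<close>
  are torsion.\<close>

lemma (in group) finite_if_central_commutator_subgroup:
  assumes P: "P \<subseteq> carrier G"
    and Z: "Z = generate G (\<Union>x\<in>P. \<Union>y\<in>carrier G. {x \<otimes> y \<otimes> inv x \<otimes> inv y})"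
    and central: "\<And>z x. z \<in> Z \<Longrightarrow> x \<in> carrier G \<Longrightarrow> z \<otimes> x = x \<otimes> z"
    and T: "finite T" "T \<subseteq> carrier G" "carrier G \<subseteq> Z <#> T"
  shows "finite (carrier G)"
proof -
  let ?c = "\<lambda>x y. x \<otimes> y \<otimes> inv x \<otimes> inv y"
  let ?K = "\<Union>x\<in>P. \<Union>y\<in>carrier G. {?c x y}"
  have K: "?K \<subseteq> carrier G" using P by auto
  have Zsub: "subgroup Z G" unfolding Z by (rule generate_is_subgroup[OF K])
  note Zc = subgroup.mem_carrier[OF Zsub]
  have KZ: "?K \<subseteq> Z" unfolding Z by (rule subsetI, rule generate.incl)
  have decomp: "\<exists>z\<in>Z. \<exists>t\<in>T. x = z \<otimes> t" if "x \<in> carrier G" for x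
    using T(3) that unfolding set_mult_def by blast
  \<comment> \<open>Expand the commutator and move the central factors z, w and their inverses
    leftwards or rightwards until each meets its inverse.\<close>
  have comm: "?c (z \<otimes> s) (w \<otimes> t) = ?c s t"
    if "z \<in> Z" "w \<in> Z" "s \<in> carrier G" "t \<in> carrier G" for z w s t
  proof -
    have zw: "z \<in> carrier G" "w \<in> carrier G" using that Zc by auto
    have cz: "z \<otimes> (inv z \<otimes> u) = u" if "u \<in> carrier G" for u
      using zw that by (simp flip: m_assoc)
    have cw: "inv w \<otimes> (w \<otimes> u) = u" if "u \<in> carrier G" for u
      using zw that by (simp flip: m_assoc)
    have iz: "inv z \<in> Z" "inv w \<in> Z" using that Zsub by (auto intro: subgroup.m_inv_closed)
    have "?c (z \<otimes> s) (w \<otimes> t) = z \<otimes> (s \<otimes> w) \<otimes> t \<otimes> inv s \<otimes> inv z \<otimes> inv t \<otimes> inv w"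
      using zw that by (simp add: inv_mult_group m_assoc)
    also have "\<dots> = z \<otimes> (w \<otimes> s) \<otimes> t \<otimes> (inv s \<otimes> inv z) \<otimes> (inv t \<otimes> inv w)"
      using zw that central[of w s] by (simp add: m_assoc)
    also have "\<dots> = z \<otimes> (w \<otimes> s) \<otimes> t \<otimes> (inv z \<otimes> inv s) \<otimes> (inv w \<otimes> inv t)"
      using zw that central[of "inv w" "inv t"] central[of "inv z" "inv s"] iz by simp
    also have "\<dots> = z \<otimes> (w \<otimes> s) \<otimes> (t \<otimes> inv z) \<otimes> (inv s \<otimes> inv w) \<otimes> inv t"
      using zw that by (simp add: m_assoc)
    also have "\<dots> = z \<otimes> (w \<otimes> s) \<otimes> (inv z \<otimes> t) \<otimes> (inv w \<otimes> inv s) \<otimes> inv t"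
      using zw that central[of "inv w" "inv s"] central[of "inv z" t] iz by simp
    also have "\<dots> = z \<otimes> (w \<otimes> s \<otimes> inv z) \<otimes> (t \<otimes> inv w) \<otimes> inv s \<otimes> inv t"
      using zw that by (simp add: m_assoc)
    also have "\<dots> = z \<otimes> (inv z \<otimes> (w \<otimes> s)) \<otimes> (inv w \<otimes> t) \<otimes> inv s \<otimes> inv t"
      using zw that central[of "inv w" t] central[of "inv z" "w \<otimes> s"] iz by simp
    also have "\<dots> = (w \<otimes> s \<otimes> inv w) \<otimes> t \<otimes> inv s \<otimes> inv t"
      using zw that by (simp add: m_assoc cz)
    also have "\<dots> = (inv w \<otimes> (w \<otimes> s)) \<otimes> t \<otimes> inv s \<otimes> inv t"
      using zw that central[of "inv w" "w \<otimes> s"] iz by simp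
    finally show ?thesis using zw that by (simp add: cw)
  qed
  have "?K \<subseteq> (\<lambda>(s, t). ?c s t) ` (T \<times> T)"
  proof
    fix k assume "k \<in> ?K"
    then obtain x y where k: "k = ?c x y" "x \<in> carrier G" "y \<in> carrier G" using P by auto
    obtain z s w t where *: "z \<in> Z" "s \<in> T" "x = z \<otimes> s" "w \<in> Z" "t \<in> T" "y = w \<otimes> t"
      using decomp[OF k(2)] decomp[OF k(3)] by blast
    then have "k = ?c s t" using comm[of z w s t] T(2) k(1) by auto
    then show "k \<in> (\<lambda>(s, t). ?c s t) ` (T \<times> T)" using * by force
  qed
  then have finK: "finite ?K" by (rule finite_subset) (use T(1) in simp)
  have torsion: "\<exists>k>0::nat. ?c x y [^] k = \<one>" if x: "x \<in> P" and y: "y \<in> carrier G" for x y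
  proof -
    have xc: "x \<in> carrier G" using x P by auto
    define k where "k = ?c x y"
    have kZ: "k \<in> Z" using KZ x y unfolding k_def by blast
    have kc: "k \<in> carrier G" using kZ Zc by auto
    have xy: "x \<otimes> y = k \<otimes> (y \<otimes> x)"
    proof -
      have "inv y \<otimes> (y \<otimes> x) = x"
        using xc y by (simp flip: m_assoc)
      then show ?thesis
        unfolding k_def using xc y by (simp add: m_assoc)
    qed
    obtain f where f: "\<And>i::nat. f i \<in> T" "\<And>i::nat. \<exists>z\<in>Z. x [^] i = z \<otimes> f i"
      using decomp[OF nat_pow_closed[OF xc]] by metis
    \<comment> \<open>Pigeonhole: infinitely many powers of x share the finitely many
      representatives in T. If \<open>x^i\<close> and \<open>x^j\<close> have the same one, then
      \<open>x^(j-i)\<close> is a quotient of two elements of Z.\<close>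
    have "\<not> inj f"
      using T(1) f(1) by (metis finite_imageD finite_subset image_subset_iff infinite_UNIV_nat)
    then obtain i j where ij: "i < j" "f i = f j"
      by (metis injI linorder_neqE_nat)
    obtain z w where z: "z \<in> Z" "x [^] i = z \<otimes> f i" and w: "w \<in> Z" "x [^] j = w \<otimes> f i"
      using f(2)[of i] f(2)[of j] ij by metis
    have fc: "f i \<in> carrier G" using f(1) T(2) by auto
    have zwc: "z \<in> carrier G" "w \<in> carrier G" using z w Zc by auto
    define n where "n = j - i"
    have "x [^] n \<otimes> x [^] i = x [^] j" using xc ij by (simp add: n_def nat_pow_mult)
    then have "x [^] n \<otimes> z \<otimes> f i = w \<otimes> f i" using z w xc fc zwc by (simp add: m_assoc)
    then have "x [^] n \<otimes> z = w" using xc fc zwc by simp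
    then have "x [^] n = w \<otimes> inv z" using xc zwc by (metis inv_solve_right nat_pow_closed)
    then have xnZ: "x [^] n \<in> Z"
      using z w Zsub by (simp add: subgroup.m_closed subgroup.m_inv_closed)
    \<comment> \<open>Each exchange of x and y costs one central factor k. For \<open>m = n\<close>
      the power \<open>x^n\<close> commutes with y as well, which leaves
      \<open>k^n = 1\<close>.\<close>
    have pow: "x [^] m \<otimes> y = k [^] m \<otimes> (y \<otimes> x [^] m)" for m :: nat
    proof (induction m)
      case 0
      then show ?case using y by simp
    next
      case (Suc m)
      have "x [^] Suc m \<otimes> y = (x [^] m \<otimes> k) \<otimes> (y \<otimes> x)"
        using xc y kc xy by (simp add: m_assoc)
      also have "x [^] m \<otimes> k = k \<otimes> x [^] m"
        using central[OF kZ, of "x [^] m"] xc by simp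
      also have "k \<otimes> x [^] m \<otimes> (y \<otimes> x) = k \<otimes> (x [^] m \<otimes> y) \<otimes> x"
        using xc y kc by (simp add: m_assoc)
      also have "\<dots> = k \<otimes> (k [^] m) \<otimes> (y \<otimes> (x [^] m \<otimes> x))"
        unfolding Suc.IH using xc y kc by (simp add: m_assoc)
      also have "k \<otimes> (k [^] m) = k [^] Suc m"
        using kc by (simp add: nat_pow_comm[of k m 1, simplified])
      finally show ?case by simp
    qed
    have "k [^] n \<otimes> (y \<otimes> x [^] n) = \<one> \<otimes> (y \<otimes> x [^] n)"
      using pow[of n] central[OF xnZ y] xc y by simp
    then have "k [^] n = \<one>" using xc y kc by simp
    then show ?thesis using ij by (auto simp: n_def k_def intro!: exI[of _ "j - i"])
  qed
  have "finite Z"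
    unfolding Z
  proof (rule finite_generate_central_torsion[OF finK K])
    show "s \<otimes> x = x \<otimes> s" if "s \<in> ?K" "x \<in> carrier G" for s x
      using central KZ that by (meson subsetD)
    show "\<exists>k>0::nat. s [^] k = \<one>" if "s \<in> ?K" for s
      using that torsion by fastforce
  qed
  then have "finite (Z <#> T)" using T(1) unfolding set_mult_def by auto
  then show ?thesis using T(3) finite_subset by blast
qed

text \<open>A conjugate of a commutator is the commutator of the conjugates, so normality of one
  term makes the generating set of the next one invariant.\<close>

lemma (in group) lower_central_series_normal: "lower_central_series G n \<lhd> G"
proof (induction n)
  case 0
  then show ?case by (simp add: normal_self)
next
  case (Suc n)
  let ?L = "lower_central_series G n"
  interpret L: normal ?L G by (rule Suc)
  show ?case unfolding lower_central_series.simps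
  proof (rule normal_generateI)
    show "(\<Union>x\<in>?L. \<Union>y\<in>carrier G. {x \<otimes> y \<otimes> inv x \<otimes> inv y}) \<subseteq> carrier G"
      using L.subset by auto
  next
    fix h g
    assume "h \<in> (\<Union>x\<in>?L. \<Union>y\<in>carrier G. {x \<otimes> y \<otimes> inv x \<otimes> inv y})" and g: "g \<in> carrier G"
    then obtain x y where xy: "x \<in> ?L" "y \<in> carrier G" "h = x \<otimes> y \<otimes> inv x \<otimes> inv y"
      by blast
    have x: "x \<in> carrier G" using xy L.subset by auto
    let ?x = "g \<otimes> x \<otimes> inv g" and ?y = "g \<otimes> y \<otimes> inv g"
    have cancel: "inv g \<otimes> (g \<otimes> z) = z" if "z \<in> carrier G" for z
      using that g by (simp flip: m_assoc)
    have "g \<otimes> h \<otimes> inv g = ?x \<otimes> ?y \<otimes> inv ?x \<otimes> inv ?y"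
      using xy x g by (simp add: inv_mult_group m_assoc cancel)
    moreover have "?x \<in> ?L" using L.inv_op_closed2 g xy by blast
    moreover have "?y \<in> carrier G" using g xy by simp
    ultimately show "g \<otimes> h \<otimes> inv g \<in> (\<Union>x\<in>?L. \<Union>y\<in>carrier G. {x \<otimes> y \<otimes> inv x \<otimes> inv y})"
      by blast
  qed
qed

lemma (in normal) finite_factor_transversal:
  assumes "finite (carrier (G Mod H))"
  obtains T where "finite T" "T \<subseteq> carrier G" "carrier G \<subseteq> H <#> T"
proof -
  define r where "r C = (SOME t. t \<in> carrier G \<and> C = H #> t)" for C
  have r: "r C \<in> carrier G \<and> C = H #> r C" if "C \<in> rcosets H" for C
    using that someI_ex[of "\<lambda>t. t \<in> carrier G \<and> C = H #> t"]
    unfolding RCOSETS_def r_def by blast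
  show ?thesis
  proof
    show "finite (r ` (rcosets H))"
      using assms by (simp add: FactGroup_def)
    show "r ` (rcosets H) \<subseteq> carrier G" using r by blast
    show "carrier G \<subseteq> H <#> r ` (rcosets H)"
    proof
      fix x assume x: "x \<in> carrier G"
      have C: "H #> x \<in> rcosets H" using x by (auto simp: RCOSETS_def)
      have "x \<in> H #> r (H #> x)"
        using r[OF C] rcos_self[OF x subgroup_axioms] by simp
      then show "x \<in> H <#> r ` (rcosets H)"
        using C unfolding r_coset_def set_mult_def by blast
    qed
  qed
qed

text \<open>In \<open>G Mod L (n + 1)\<close> the image of \<open>L n\<close> is central, and its
  index is finite by assumption. As \<open>n > 0\<close>, \<open>L n\<close> is itself generated by
  commutators with elements of \<open>L (n - 1)\<close>, so the criterion for central commutator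
  subgroups applies inside this factor group.\<close>

lemma (in group) finite_factor_lower_central_series_step:
  assumes "finite (carrier (G Mod lower_central_series G n))" "n > 0"
  shows "finite (carrier (G Mod lower_central_series G (Suc n)))"
proof -
  let ?L = "lower_central_series G" and ?N = "lower_central_series G (Suc n)"
  let ?H = "G Mod ?N" and ?q = "\<lambda>x. ?N #> x"
  note lower_central_series.simps(2)[simp del]
  interpret N: normal ?N G by (rule lower_central_series_normal)
  interpret L: normal "?L n" G by (rule lower_central_series_normal)
  interpret H: group ?H by (rule N.factorgroup_is_group)
  interpret q: group_hom G ?H ?q
    using N.r_coset_hom_Mod H.is_group by (intro group_hom.intro group_hom_axioms.intro) auto
  have surj: "carrier ?H = ?q ` carrier G"
    by (auto simp: FactGroup_def RCOSETS_def)
  obtain m where m: "n = Suc m" using assms(2) by (cases n) auto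
  obtain T where T: "finite T" "T \<subseteq> carrier G" "carrier G \<subseteq> ?L n <#> T"
    using L.finite_factor_transversal[OF assms(1)] .
  have Lm: "?L m \<subseteq> carrier G"
    using lower_central_series_normal[of m] normal_imp_subgroup subgroup.subset by blast
  let ?K = "\<Union>x\<in>?L m. \<Union>y\<in>carrier G. {x \<otimes> y \<otimes> inv x \<otimes> inv y}"
  have K: "?K \<subseteq> carrier G" using Lm by auto
  show ?thesis
  proof (rule H.finite_if_central_commutator_subgroup)
    show "?q ` ?L m \<subseteq> carrier ?H" using Lm by auto
    have c: "?q (x \<otimes> y \<otimes> inv x \<otimes> inv y) =
        ?q x \<otimes>\<^bsub>?H\<^esub> ?q y \<otimes>\<^bsub>?H\<^esub> inv\<^bsub>?H\<^esub> ?q x \<otimes>\<^bsub>?H\<^esub> inv\<^bsub>?H\<^esub> ?q y"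
      if "x \<in> carrier G" "y \<in> carrier G" for x y
      using that by (simp del: N.rcos_sum)
    have Ln: "?L n = generate G ?K" unfolding m by (rule lower_central_series.simps(2))
    have "?q ` ?L n = generate ?H (?q ` ?K)"
      by (subst Ln) (rule q.generate_img[OF K, symmetric])
    also have "?q ` ?K = (\<Union>x\<in>?q ` ?L m. \<Union>y\<in>carrier ?H.
        {x \<otimes>\<^bsub>?H\<^esub> y \<otimes>\<^bsub>?H\<^esub> inv\<^bsub>?H\<^esub> x \<otimes>\<^bsub>?H\<^esub> inv\<^bsub>?H\<^esub> y})"
      unfolding surj image_UN UN_simps image_insert image_empty
      by (intro SUP_cong refl) (use c Lm in blast)
    finally show "?q ` ?L n = generate ?H \<dots>" .
    show "finite (?q ` T)" using T by simp
    show "?q ` T \<subseteq> carrier ?H" using T by auto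
    show "carrier ?H \<subseteq> ?q ` ?L n <#>\<^bsub>?H\<^esub> ?q ` T"
    proof
      fix C assume "C \<in> carrier ?H"
      then obtain x where x: "x \<in> carrier G" "C = ?q x" using surj by blast
      then obtain z t where zt: "z \<in> ?L n" "t \<in> T" "x = z \<otimes> t"
        using T(3) unfolding set_mult_def by blast
      then have "C = ?q z \<otimes>\<^bsub>?H\<^esub> ?q t" using x T(2) L.subset by (metis q.hom_mult subsetD)
      then show "C \<in> ?q ` ?L n <#>\<^bsub>?H\<^esub> ?q ` T" using zt unfolding set_mult_def by blast
    qed
  next
    fix C D assume "C \<in> ?q ` ?L n" "D \<in> carrier ?H"
    then obtain z x where z: "z \<in> ?L n" "C = ?q z" and x: "x \<in> carrier G" "D = ?q x"
      using surj by blast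
    have zc: "z \<in> carrier G" using z L.subset by auto
    \<comment> \<open>Centrality in the factor group: zx is the commutator times xz, and the
      commutator lies in the subgroup divided out, so both products have the same coset.\<close>
    have "z \<otimes> x \<otimes> inv z \<otimes> inv x \<in> ?N"
      using z x unfolding lower_central_series.simps(2) by (blast intro: generate.incl)
    then have "(z \<otimes> x \<otimes> inv z \<otimes> inv x) \<otimes> (x \<otimes> z) \<in> ?N #> (x \<otimes> z)"
      unfolding r_coset_def by blast
    moreover have "(z \<otimes> x \<otimes> inv z \<otimes> inv x) \<otimes> (x \<otimes> z) = z \<otimes> x"
      using zc x(1) by (simp add: m_assoc) (simp flip: m_assoc)
    ultimately have "?q (z \<otimes> x) = ?q (x \<otimes> z)"
      using zc x(1) N.subgroup_axioms by (metis m_closed repr_independence)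
    then show "C \<otimes>\<^bsub>?H\<^esub> D = D \<otimes>\<^bsub>?H\<^esub> C"
      using z x zc by (metis q.hom_mult)
  qed
qed

text \<open>The induction starts at \<open>L 1\<close>, which is the derived subgroup, and ends at a
  trivial term, where a finite transversal is the whole group. If already \<open>L 0\<close> is
  trivial, so is the group.\<close>

lemma nilpotent_group_finite_if_finite_abelianization:
  assumes "nilpotent_group G" and "finite (carrier (abelianization G))"
  shows "finite (carrier G)"
proof -
  interpret group G using assms(1) by (simp add: nilpotent_group_def)
  obtain n where n: "lower_central_series G n = {\<one>\<^bsub>G\<^esub>}"
    using assms(1) by (auto simp: nilpotent_group_def)
  have D: "finite (carrier (G Mod lower_central_series G (Suc k)))" for k
  proof (induction k)
    case 0
    then show ?case
      using assms(2) by (simp add: abelianization_def derived_def)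
  next
    case (Suc k)
    then show ?case by (rule finite_factor_lower_central_series_step) simp
  qed
  show ?thesis
  proof (cases n)
    case 0
    then show ?thesis using n by simp
  next
    case (Suc k)
    interpret N: normal "lower_central_series G n" G by (rule lower_central_series_normal)
    obtain T where T: "finite T" "T \<subseteq> carrier G" "carrier G \<subseteq> {\<one>\<^bsub>G\<^esub>} <#>\<^bsub>G\<^esub> T"
      using N.finite_factor_transversal[OF D[of k, folded Suc]] unfolding n by blast
    have "\<one>\<^bsub>G\<^esub> \<otimes>\<^bsub>G\<^esub> t = t" if "t \<in> T" for t
      using that T(2) by (intro l_one) blast
    then have "{\<one>\<^bsub>G\<^esub>} <#>\<^bsub>G\<^esub> T = T"
      unfolding set_mult_def by simp
    then show ?thesis using T finite_subset by metis
  qed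
qed

section \<open>Words in a group and harmonic functions on a finite group\<close>

lemma (in group) word_prod_closed:
  "set t \<subseteq> carrier G \<Longrightarrow> word_prod G t \<in> carrier G"
  unfolding word_prod_def by (induction t) auto

lemma (in group) word_prod_append:
  "set t \<subseteq> carrier G \<Longrightarrow> set u \<subseteq> carrier G \<Longrightarrow>
    word_prod G (t @ u) = word_prod G t \<otimes> word_prod G u"
proof (induction t)
  case Nil
  then show ?case using word_prod_closed[of u] by (simp add: word_prod_def)
next
  case (Cons s t)
  then show ?case
    using word_prod_closed[of u] word_prod_closed[of t] by (simp add: word_prod_def m_assoc)
qed

text \<open>Summing the harmonicity equation over the group forces the total weight to be 1; then the
  maximum of \<open>\<psi>\<close> propagates along the generators.\<close>

lemma (in group) harmonic_on_finite_group_constant: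
  fixes \<psi> w :: "'a \<Rightarrow> real"
  assumes fin: "finite (carrier G)" and Y: "Y \<subseteq> carrier G" and gen: "semigroup_generates G Y"
    and w: "\<And>s. s \<in> Y \<Longrightarrow> w s > 0"
    and \<psi>: "\<And>g. g \<in> carrier G \<Longrightarrow> \<psi> g \<ge> 0" and one: "\<psi> \<one> = 1"
    and harm: "\<And>g. g \<in> carrier G \<Longrightarrow> \<psi> g = (\<Sum>s\<in>Y. w s * \<psi> (g \<otimes> s))"
  shows "(\<Sum>s\<in>Y. w s) = 1 \<and> (\<forall>g\<in>carrier G. \<psi> g = 1)"
proof -
  have finY: "finite Y" using fin Y finite_subset by blast
  let ?S = "\<Sum>g\<in>carrier G. \<psi> g"
  have "?S = (\<Sum>g\<in>carrier G. \<Sum>s\<in>Y. w s * \<psi> (g \<otimes> s))"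
    using harm by (rule sum.cong[OF refl])
  also have "\<dots> = (\<Sum>s\<in>Y. \<Sum>g\<in>carrier G. w s * \<psi> (g \<otimes> s))"
    by (rule sum.swap)
  also have "\<dots> = (\<Sum>s\<in>Y. w s * ?S)"
  proof (rule sum.cong[OF refl])
    fix s assume s: "s \<in> Y"
    have "bij_betw (\<lambda>g. g \<otimes> s) (carrier G) (carrier G)"
      using s Y by (intro bij_betw_byWitness[where f' = "\<lambda>g. g \<otimes> inv s"]) (auto simp: m_assoc)
    then have "(\<Sum>g\<in>carrier G. \<psi> (g \<otimes> s)) = ?S"
      by (rule sum.reindex_bij_betw)
    then show "(\<Sum>g\<in>carrier G. w s * \<psi> (g \<otimes> s)) = w s * ?S"
      by (simp flip: sum_distrib_left)
  qed
  also have "\<dots> = (\<Sum>s\<in>Y. w s) * ?S"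
    by (simp add: sum_distrib_right)
  finally have eq: "?S = (\<Sum>s\<in>Y. w s) * ?S" .
  \<comment> \<open>As \<open>\<psi> \<one> = 1\<close>, the total is positive and cancels from the
    equation above.\<close>
  have "\<psi> \<one> \<le> ?S"
    using fin \<psi> by (intro member_le_sum) auto
  then have sum1: "(\<Sum>s\<in>Y. w s) = 1" using eq one by simp
  define M where "M = Max (\<psi> ` carrier G)"
  have le: "\<psi> g \<le> M" if "g \<in> carrier G" for g
    using that fin by (simp add: M_def)
  \<comment> \<open>At a maximum, M is a weighted mean of values not exceeding M, with positive
    weights of sum 1; none of them can lie below M.\<close>
  have step: "\<psi> (g \<otimes> s) = M" if g: "g \<in> carrier G" "\<psi> g = M" and s: "s \<in> Y" for g s
  proof -
    have "(\<Sum>s\<in>Y. w s * (M - \<psi> (g \<otimes> s))) = 0"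
      using harm[OF g(1)] sum1 g(2)
      by (simp add: right_diff_distrib sum_subtractf flip: sum_distrib_right)
    moreover have "\<And>s. s \<in> Y \<Longrightarrow> w s * (M - \<psi> (g \<otimes> s)) \<ge> 0"
      using w le g Y by (simp add: less_imp_le subset_iff)
    ultimately have "w s * (M - \<psi> (g \<otimes> s)) = 0"
      using s sum_nonneg_eq_0_iff[OF finY, of "\<lambda>s. w s * (M - \<psi> (g \<otimes> s))"] by simp
    then show ?thesis using w[OF s] by simp
  qed
  have "M \<in> \<psi> ` carrier G"
    unfolding M_def using fin one_closed by (intro Max_in) auto
  then obtain g0 where g0: "g0 \<in> carrier G" "\<psi> g0 = M" by auto
  have path: "\<psi> (g \<otimes> word_prod G t) = M" if "g \<in> carrier G" "\<psi> g = M" "t \<in> lists Y" for g t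
    using that
  proof (induction t arbitrary: g)
    case Nil
    then show ?case by (simp add: word_prod_def)
  next
    case (Cons s t)
    have s: "s \<in> carrier G" and t: "word_prod G t \<in> carrier G"
      using Cons.prems Y by (auto intro!: word_prod_closed)
    have "g \<otimes> word_prod G (s # t) = (g \<otimes> s) \<otimes> word_prod G t"
      using s t Cons.prems by (simp add: word_prod_def m_assoc)
    then show ?case
      using Cons step[of g s] s by auto
  qed
  have const: "\<psi> g = M" if g: "g \<in> carrier G" for g
  proof -
    \<comment> \<open>The maximum spreads only in the forward direction, along right multiplication
      by Y. Semigroup generation writes \<open>inv g0 \<otimes> g\<close> without inverses of
      generators, so every g is reached from g0.\<close>
    have "inv g0 \<otimes> g \<in> carrier G" using g g0 by simp
    then obtain t where t: "t \<in> lists Y" "inv g0 \<otimes> g = word_prod G t"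
      using gen unfolding semigroup_generates_def by auto
    then have "\<psi> (g0 \<otimes> (inv g0 \<otimes> g)) = M" using path g0 by simp
    then show ?thesis using g g0 by (simp flip: m_assoc)
  qed
  then have "M = 1" using one one_closed by metis
  then show ?thesis using sum1 const by simp
qed

section \<open>KMS states and eigenvectors of the dynamics\<close>

text \<open>Entire orbits are tied to \<alpha> at real times only; the identity theorem extends
  relations between them, tested by a functional, to complex times.\<close>

lemma entire_eqI_real_line:
  assumes f: "f holomorphic_on UNIV" and g: "g holomorphic_on UNIV"
    and eq: "\<And>r. f (complex_of_real r) = g (complex_of_real r)"
  shows "f z = g z"
proof -
  have "(0::complex) islimpt range complex_of_real"
    unfolding islimpt_approachable
  proof (intro allI impI)
    fix e :: real assume "e > 0"
    then show "\<exists>x'\<in>range complex_of_real. x' \<noteq> 0 \<and> dist x' 0 < e"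
      by (intro bexI[of _ "complex_of_real (e / 2)"] rangeI) auto
  qed
  then have "f z - g z = 0"
    using analytic_continuation[OF holomorphic_on_diff[OF f g] open_UNIV connected_UNIV,
        of "range complex_of_real" 0 z] eq by auto
  then show ?thesis by simp
qed

text \<open>A primitive of \<open>k\<close> grows like \<open>c0 T\<close> and \<open>c1 T\<close> along the two edges of the strip, up to an
  error \<open>\<epsilon> T\<close>, while its two boundary values over the same point stay at bounded distance.\<close>

lemma strip_boundary_constants_close:
  fixes k :: "complex \<Rightarrow> complex"
  assumes k: "k holomorphic_on UNIV"
    and bd: "\<And>x y. y \<in> closed_segment 0 \<beta> \<Longrightarrow> cmod (k (Complex x y)) \<le> C"
    and k0: "\<And>x. cmod (k (Complex x 0) - c0) \<le> \<epsilon>"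
    and k1: "\<And>x. cmod (k (Complex x \<beta>) - c1) \<le> \<epsilon>"
  shows "cmod (c0 - c1) \<le> 2 * \<epsilon>"
proof -
  obtain K where K: "\<And>z. (K has_field_derivative k z) (at z)"
    using holomorphic_convex_primitive'[OF convex_UNIV open_UNIV k] by auto
  have edge: "cmod (K (Complex T y) - K (Complex 0 y) - c * complex_of_real T) \<le> \<epsilon> * T"
    if T: "T > 0" and c: "\<And>x. cmod (k (Complex x y) - c) \<le> \<epsilon>" for T y c
  proof -
    have conv: "convex {z. Im z = y}"
      using convex_linear_vimage[OF _ convex_singleton[of y], of Im]
      by (simp add: linearI vimage_def)
    \<comment> \<open>Mean value inequality for \<open>K z - c z\<close>, whose derivative
      \<open>k z - c\<close> is at most \<epsilon> on this horizontal line.\<close>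
    have "cmod ((K (Complex T y) - c * Complex T y) - (K (Complex 0 y) - c * Complex 0 y))
        \<le> \<epsilon> * cmod (Complex T y - Complex 0 y)"
    proof (rule field_differentiable_bound[OF conv, where f' = "\<lambda>z. k z - c"])
      fix z assume "z \<in> {z. Im z = y}"
      then show "cmod (k z - c) \<le> \<epsilon>" using c[of "Re z"] by (cases z) simp
      have "((\<lambda>z. K z - c * z) has_field_derivative k z - c * 1) (at z)"
        by (intro DERIV_diff K DERIV_cmult DERIV_ident)
      then show "((\<lambda>z. K z - c * z) has_field_derivative k z - c) (at z within {z. Im z = y})"
        by (simp add: has_field_derivative_at_within)
    qed auto
    moreover have "Complex T y - Complex 0 y = complex_of_real T"
      by (simp add: complex_eq_iff)
    moreover have "(K (Complex T y) - c * Complex T y) - (K (Complex 0 y) - c * Complex 0 y)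
        = K (Complex T y) - K (Complex 0 y) - c * (Complex T y - Complex 0 y)"
      by (simp add: algebra_simps)
    ultimately show ?thesis using T by simp
  qed
  have side: "cmod (K (Complex x \<beta>) - K (Complex x 0)) \<le> C * \<bar>\<beta>\<bar>" for x
  proof -
    \<comment> \<open>A segment instead of an interval, because \<beta> may have either
      sign.\<close>
    have conv: "convex {z. Re z = x \<and> Im z \<in> closed_segment 0 \<beta>}"
    proof -
      have "{z. Re z = x \<and> Im z \<in> closed_segment 0 \<beta>} = Re -` {x} \<inter> Im -` closed_segment 0 \<beta>"
        by auto
      then show ?thesis
        by (simp add: convex_Int convex_linear_vimage linearI)
    qed
    have "cmod (K (Complex x \<beta>) - K (Complex x 0)) \<le> C * cmod (Complex x \<beta> - Complex x 0)"
    proof (rule field_differentiable_bound[OF conv, where f' = k])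
      fix z assume "z \<in> {z. Re z = x \<and> Im z \<in> closed_segment 0 \<beta>}"
      then show "cmod (k z) \<le> C" using bd[of "Im z" "Re z"] by (cases z) simp
      show "(K has_field_derivative k z) (at z within {z. Re z = x \<and> Im z \<in> closed_segment 0 \<beta>})"
        by (rule has_field_derivative_at_within[OF K])
    qed auto
    moreover have "Complex x \<beta> - Complex x 0 = \<i> * complex_of_real \<beta>"
      by (simp add: complex_eq_iff)
    ultimately show ?thesis by (simp add: norm_mult)
  qed
  have main: "T * cmod (c0 - c1) \<le> 2 * \<epsilon> * T + 2 * (C * \<bar>\<beta>\<bar>)" if T: "T > 0" for T
  proof -
    let ?a = "K (Complex T \<beta>) - K (Complex 0 \<beta>) - c1 * complex_of_real T"
    let ?b = "K (Complex T 0) - K (Complex 0 0) - c0 * complex_of_real T"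
    let ?c = "K (Complex T \<beta>) - K (Complex T 0)" and ?d = "K (Complex 0 \<beta>) - K (Complex 0 0)"
    have eq: "complex_of_real T * (c0 - c1) = ?a - ?b - ?c + ?d"
      by (simp add: algebra_simps)
    have "cmod (a - b - c + d) \<le> cmod a + cmod b + cmod c + cmod d" for a b c d
      using norm_triangle_ineq[of "a - b - c" d] norm_triangle_ineq4[of "a - b" c]
        norm_triangle_ineq4[of a b] by linarith
    then have "cmod (complex_of_real T * (c0 - c1)) \<le> cmod ?a + cmod ?b + cmod ?c + cmod ?d"
      unfolding eq .
    then have "cmod (complex_of_real T * (c0 - c1)) \<le> 2 * \<epsilon> * T + 2 * (C * \<bar>\<beta>\<bar>)"
      using edge[OF T k0] edge[OF T k1] side[of T] side[of 0] by linarith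
    then show ?thesis using T by (simp add: norm_mult)
  qed
  show ?thesis
  proof (rule ccontr)
    assume "\<not> ?thesis"
    then have d: "cmod (c0 - c1) - 2 * \<epsilon> > 0" by simp
    define D where "D = cmod (c0 - c1) - 2 * \<epsilon>"
    \<comment> \<open>Chosen so that \<open>T * D\<close> exceeds the bound
      \<open>2 * (C * \<bar>\<beta>\<bar>)\<close>, which does not grow with T. The outer absolute
      value is there because no sign of C is assumed.\<close>
    define T where "T = (2 * \<bar>C * \<bar>\<beta>\<bar>\<bar> + 1) / D"
    have T: "T > 0" using d by (simp add: T_def D_def)
    have "T * D \<le> 2 * (C * \<bar>\<beta>\<bar>)" using main[OF T] by (simp add: D_def algebra_simps)
    moreover have "T * D = 2 * \<bar>C * \<bar>\<beta>\<bar>\<bar> + 1" using d by (simp add: T_def D_def)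
    ultimately show False by linarith
  qed
qed

text \<open>L is linear and bounded on A only, so the derivative d must first be located in A: it is
  a limit of difference quotients, and these stay in the closed subspace A. The error term of f then
  passes through L at the cost of a factor C.\<close>

lemma bounded_functional_has_field_derivative:
  fixes f :: "complex \<Rightarrow> 'a::cstar_algebra" and L :: "'a \<Rightarrow> complex"
  assumes A: "csubspace A" "closed A" and f: "range f \<subseteq> A"
    and add: "\<And>a b. a \<in> A \<Longrightarrow> b \<in> A \<Longrightarrow> L (a + b) = L a + L b"
    and scale: "\<And>c a. a \<in> A \<Longrightarrow> L (c *\<^sub>C a) = c * L a"
    and bd: "\<And>a. a \<in> A \<Longrightarrow> cmod (L a) \<le> C * norm a"
    and D: "(f has_derivative (\<lambda>h. h *\<^sub>C d)) (at z)"
  shows "((\<lambda>z. L (f z)) has_field_derivative L d) (at z)"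
proof -
  have fA: "f w \<in> A" for w using f by auto
  let ?e = "\<lambda>h. f (z + h) - f z - h *\<^sub>C d"
  have lim: "((\<lambda>h. norm (?e h) / norm h) \<longlongrightarrow> 0) (at 0)"
    using D unfolding has_derivative_at by simp
  have "((\<lambda>h. inverse h *\<^sub>C (f (z + h) - f z)) \<longlongrightarrow> d) (at 0)"
  proof (rule tendsto_norm_zero_cancel[THEN LIM_zero_cancel])
    have "norm (inverse h *\<^sub>C (f (z + h) - f z) - d) = norm (?e h) / norm h" if "h \<noteq> 0" for h
    proof -
      have "inverse h *\<^sub>C (h *\<^sub>C d) = d" using that by (simp add: scaleC_scaleC)
      then have "inverse h *\<^sub>C (f (z + h) - f z) - d = inverse h *\<^sub>C ?e h"
        by (simp only: complex_vector.scale_right_diff_distrib)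
      then show ?thesis by (simp add: norm_scaleC norm_inverse divide_inverse mult.commute)
    qed
    then have "\<forall>\<^sub>F h in at 0. norm (?e h) / norm h = norm (inverse h *\<^sub>C (f (z + h) - f z) - d)"
      by (simp add: eventually_at_filter)
    then show "((\<lambda>h. norm (inverse h *\<^sub>C (f (z + h) - f z) - d)) \<longlongrightarrow> 0) (at 0)"
      using lim by (rule Lim_transform_eventually[rotated])
  qed
  moreover have "inverse h *\<^sub>C (f (z + h) - f z) \<in> A" for h
    using A fA by (simp add: complex_vector.subspace_scale complex_vector.subspace_diff)
  ultimately have d: "d \<in> A"
    using Lim_in_closed_set[OF A(2)] by (metis (no_types, lifting) always_eventually trivial_limit_at)
  have diff: "L (a - b) = L a - L b" if "a \<in> A" "b \<in> A" for a b
    using add[of "a - b" b] that A by (simp add: complex_vector.subspace_diff)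
  have "((\<lambda>h. norm (L (f (z + h)) - L (f z) - L d * h) / norm h) \<longlongrightarrow> 0) (at 0)"
  proof (rule Lim_null_comparison)
    have "norm (norm (L (f (z + h)) - L (f z) - L d * h) / norm h) \<le> C * (norm (?e h) / norm h)" for h
    proof -
      have "L (f (z + h)) - L (f z) - L d * h = L (?e h)"
        using A d fA by (simp add: diff scale complex_vector.subspace_scale complex_vector.subspace_diff)
      moreover have "?e h \<in> A"
        using A d fA by (simp add: complex_vector.subspace_scale complex_vector.subspace_diff)
      ultimately have "norm (L (f (z + h)) - L (f z) - L d * h) \<le> C * norm (?e h)"
        using bd by simp
      then show ?thesis by (simp add: divide_right_mono)
    qed
    then show "\<forall>\<^sub>F h in at 0. norm (norm (L (f (z + h)) - L (f z) - L d * h) / norm h)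
        \<le> C * (norm (?e h) / norm h)" by simp
    show "((\<lambda>h. C * (norm (?e h) / norm h)) \<longlongrightarrow> 0) (at 0)"
      using tendsto_mult_left[OF lim, of C] by simp
  qed
  then show ?thesis
    unfolding has_field_derivative_def has_derivative_at by (simp add: bounded_linear_mult_right)
qed

lemma entire_orbitD:
  assumes "entire_orbit A \<alpha> a f"
  shows "f z \<in> A" and "\<exists>d. (f has_derivative (\<lambda>h. h *\<^sub>C d)) (at z)"
    and "f (complex_of_real r) = \<alpha> r a"
  using assms unfolding entire_orbit_def by auto

lemma one_parameter_groupD:
  assumes "one_parameter_group A \<alpha>" "a \<in> A"
  shows "\<alpha> r a \<in> A" and "\<alpha> (r + s) a = \<alpha> r (\<alpha> s a)" and "norm (\<alpha> r a) = norm a"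
    and "b \<in> A \<Longrightarrow> \<alpha> r (a + b) = \<alpha> r a + \<alpha> r b" and "\<alpha> r (c *\<^sub>C a) = c *\<^sub>C \<alpha> r a"
  using assms
  unfolding one_parameter_group_def star_automorphism_def clinear_on_set_def bij_betw_def
  by blast+

text \<open>The KMS condition on a dense subalgebra passes to eigenvectors of the dynamics outside it:
  after approximating by elements of the subalgebra, the entire function
  \<open>z \<mapsto> exp (-i\<mu>z) \<omega>(b \<alpha>\<^sub>z(a))\<close> is nearly constant on both edges of the strip of width \<open>\<beta>\<close>.\<close>

lemma kms_eigenvector:
  fixes \<omega> :: "'a::cstar_algebra \<Rightarrow> complex"
  assumes B: "star_subalgebra B" "closed B"
    and add: "\<And>a b. a \<in> B \<Longrightarrow> b \<in> B \<Longrightarrow> \<omega> (a + b) = \<omega> a + \<omega> b"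
    and scale: "\<And>c a. a \<in> B \<Longrightarrow> \<omega> (c *\<^sub>C a) = c * \<omega> a"
    and bd: "\<And>a. a \<in> B \<Longrightarrow> cmod (\<omega> a) \<le> norm a"
    and \<alpha>: "one_parameter_group B \<alpha>"
    and AB: "A \<subseteq> B" and kms: "kms_state A \<alpha> \<beta> \<omega>"
    and a: "a \<in> A" and b: "b \<in> A"
    and eig: "\<And>r. \<alpha> r a = exp (\<i> * complex_of_real (r * \<mu>)) *\<^sub>C a"
  shows "\<omega> (b * a) = exp (complex_of_real (\<beta> * \<mu>)) * \<omega> (a * b)"
proof -
  obtain \<A> where \<A>: "star_subalgebra \<A>" "\<A> \<subseteq> A" "A \<subseteq> closure \<A>" "\<And>r x. x \<in> \<A> \<Longrightarrow> \<alpha> r x \<in> \<A>"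
    and orbit: "\<And>a. a \<in> \<A> \<Longrightarrow> \<exists>f. entire_orbit A \<alpha> a f
        \<and> (\<forall>b\<in>\<A>. \<omega> (a * b) = \<omega> (b * f (\<i> * complex_of_real \<beta>)))"
    using kms unfolding kms_state_def by (metis image_subset_iff)
  have Bsub: "csubspace B" using B by (simp add: star_subalgebra_def)
  have mult: "x * y \<in> B" if "x \<in> B" "y \<in> B" for x y
    using B that by (simp add: star_subalgebra_def)
  have \<A>B: "x \<in> B" if "x \<in> \<A>" for x using that \<A> AB by auto
  have diff: "\<omega> (x - y) = \<omega> x - \<omega> y" if "x \<in> B" "y \<in> B" for x y
    using add[of "x - y" y] that Bsub by (simp add: complex_vector.subspace_diff)
  have \<alpha>diff: "\<alpha> r (x - y) = \<alpha> r x - \<alpha> r y" if "x \<in> B" "y \<in> B" for r x y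
    using one_parameter_groupD(4)[OF \<alpha>, of "x - y" y r] that Bsub
    by (simp add: complex_vector.subspace_diff)
  \<comment> \<open>The shift by c lets one statement cover an orbit and its translates.\<close>
  have holo: "(\<lambda>z. L (f (z + c))) holomorphic_on UNIV"
    if f: "entire_orbit A \<alpha> x f" and Ladd: "\<And>x y. x \<in> B \<Longrightarrow> y \<in> B \<Longrightarrow> L (x + y) = L x + L y"
      and Lscale: "\<And>c x. x \<in> B \<Longrightarrow> L (c *\<^sub>C x) = c * L x"
      and Lbd: "\<And>x. x \<in> B \<Longrightarrow> cmod (L x) \<le> C * norm x" for L f x c C
  proof -
    have rf: "range f \<subseteq> B" using entire_orbitD(1)[OF f] AB by auto
    have hol: "(\<lambda>z. L (f z)) holomorphic_on UNIV"
      unfolding holomorphic_on_def field_differentiable_def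
    proof
      fix z
      obtain d where "(f has_derivative (\<lambda>h. h *\<^sub>C d)) (at z)" using entire_orbitD(2)[OF f] by blast
      from bounded_functional_has_field_derivative[OF Bsub B(2) rf Ladd Lscale Lbd this]
      show "\<exists>f'. ((\<lambda>z. L (f z)) has_field_derivative f') (at z within UNIV)" by auto
    qed
    have "(\<lambda>z. z + c) holomorphic_on UNIV" by (intro holomorphic_intros)
    from holomorphic_on_compose_gen[OF this hol] show ?thesis by (simp add: comp_def)
  qed
  have \<omega>add: "\<omega> (y * (u + v)) = \<omega> (y * u) + \<omega> (y * v)" if "y \<in> B" "u \<in> B" "v \<in> B" for y u v
    using add[OF mult[OF that(1,2)] mult[OF that(1,3)]] by (simp add: distrib_left)
  have \<omega>scale: "\<omega> (y * (c *\<^sub>C u)) = c * \<omega> (y * u)" if "y \<in> B" "u \<in> B" for y u c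
    using scale[OF mult[OF that]] by (simp add: mult_scaleC_right)
  have \<omega>bd: "cmod (\<omega> (y * u)) \<le> norm y * norm u" if "y \<in> B" "u \<in> B" for y u
    using bd[OF mult[OF that]] norm_mult_ineq[of y u] by linarith
  note \<omega>mult = \<omega>add \<omega>scale \<omega>bd
  have \<alpha>D: "\<alpha> r u \<in> B" "norm (\<alpha> r u) = norm u" "\<alpha> r (c *\<^sub>C u) = c *\<^sub>C \<alpha> r u" if "u \<in> B" for r u c
    using one_parameter_groupD[OF \<alpha> that] by auto
  have \<alpha>add: "\<alpha> r (u + v) = \<alpha> r u + \<alpha> r v" if "u \<in> B" "v \<in> B" for r u v
    using one_parameter_groupD(4)[OF \<alpha> that] .
  define q where "q = exp (\<beta> * \<mu>)"
  \<comment> \<open>Size of the error in a product: for \<delta> at most 1, changing both factors by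
    at most \<delta> changes the product by at most \<open>\<delta> * M\<close>. The number q above
    is the expected KMS factor.\<close>
  define M where "M = norm a + norm b + 1"
  have main: "cmod (\<omega> (b * a) - complex_of_real q * \<omega> (a * b)) \<le> \<delta> * (2 * (1 + q) * M)"
    if \<delta>: "\<delta> > 0" "\<delta> \<le> 1" for \<delta>
  proof -
    obtain a' where a': "a' \<in> \<A>" "norm (a' - a) < \<delta>"
      using \<A>(3) a \<delta>(1) unfolding subset_eq closure_approachable dist_norm by blast
    obtain b' where b': "b' \<in> \<A>" "norm (b' - b) < \<delta>"
      using \<A>(3) b \<delta>(1) unfolding subset_eq closure_approachable dist_norm by blast
    have aB: "a \<in> B" "b \<in> B" "a' \<in> B" "b' \<in> B" using a b a' b' \<A>B AB by auto
    obtain f where f: "entire_orbit A \<alpha> a' f"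
      using orbit[OF a'(1)] by blast
    have fB: "f z \<in> B" for z using entire_orbitD(1)[OF f] AB by auto
    \<comment> \<open>The group law \<open>\<alpha>_(z+x) = \<alpha>_x \<alpha>_z\<close> for
      complex z, in the tested form that suffices: both sides are entire in z and agree for real
      z.\<close>
    have shift: "\<omega> (b' * f (z + complex_of_real x)) = \<omega> (b' * \<alpha> x (f z))" for z x
    proof (rule entire_eqI_real_line[where f = "\<lambda>z. \<omega> (b' * f (z + complex_of_real x))"])
      show "(\<lambda>z. \<omega> (b' * f (z + complex_of_real x))) holomorphic_on UNIV"
        by (rule holo[OF f, where C = "norm b'"]) (simp_all add: \<omega>mult aB)
      have "(\<lambda>z. \<omega> (b' * \<alpha> x (f (z + 0)))) holomorphic_on UNIV"
        by (rule holo[OF f, where C = "norm b'" and L = "\<lambda>u. \<omega> (b' * \<alpha> x u)"])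
          (use \<omega>bd[OF aB(4) \<alpha>D(1)] in \<open>simp_all add: \<omega>add \<omega>scale \<alpha>D \<alpha>add aB\<close>)
      then show "(\<lambda>z. \<omega> (b' * \<alpha> x (f z))) holomorphic_on UNIV" by simp
      fix r
      show "\<omega> (b' * f (complex_of_real r + complex_of_real x)) = \<omega> (b' * \<alpha> x (f (complex_of_real r)))"
        using entire_orbitD(3)[OF f, of "r + x"] entire_orbitD(3)[OF f, of r]
          one_parameter_groupD(2)[OF \<alpha> aB(3), of x r]
        by (simp add: add.commute)
    qed
    \<comment> \<open>The KMS identity is applied to \<open>\<alpha> x a'\<close>, which is in the
      subalgebra by invariance. Its orbit f' is the translate of f by x, as far as
      \<open>\<omega> (b' * _)\<close> can see.\<close>
    have top: "\<omega> (b' * f (\<i> * complex_of_real \<beta> + complex_of_real x)) = \<omega> (\<alpha> x a' * b')" for x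
    proof -
      obtain f' where f': "entire_orbit A \<alpha> (\<alpha> x a') f'"
        "\<And>y. y \<in> \<A> \<Longrightarrow> \<omega> (\<alpha> x a' * y) = \<omega> (y * f' (\<i> * complex_of_real \<beta>))"
        using orbit[OF \<A>(4)[OF a'(1)]] by blast
      have "\<omega> (b' * f (z + complex_of_real x)) = \<omega> (b' * f' z)" for z
      proof (rule entire_eqI_real_line[where f = "\<lambda>z. \<omega> (b' * f (z + complex_of_real x))"])
        show "(\<lambda>z. \<omega> (b' * f (z + complex_of_real x))) holomorphic_on UNIV"
          by (rule holo[OF f, where C = "norm b'"]) (simp_all add: \<omega>mult aB)
        have "(\<lambda>z. \<omega> (b' * f' (z + 0))) holomorphic_on UNIV"
          by (rule holo[OF f'(1), where C = "norm b'"]) (simp_all add: \<omega>mult aB)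
        then show "(\<lambda>z. \<omega> (b' * f' z)) holomorphic_on UNIV" by simp
        fix r
        show "\<omega> (b' * f (complex_of_real r + complex_of_real x)) = \<omega> (b' * f' (complex_of_real r))"
          using entire_orbitD(3)[OF f, of "r + x"] entire_orbitD(3)[OF f'(1), of r]
            one_parameter_groupD(2)[OF \<alpha> aB(3), of r x]
          by simp
      qed
      then show ?thesis using f'(2)[OF b'(1)] by simp
    qed
    have split: "Complex x y = \<i> * complex_of_real y + complex_of_real x" for x y
      by (simp add: complex_eq_iff)
    \<comment> \<open>The exponential compensates the eigenvalue: for the exact eigenvector a the
      orbit would be \<open>exp (i\<mu>z) a\<close> and k would be constant. With a' and b' it is
      close to \<open>\<omega> (b * a)\<close> on the real line and to
      \<open>q * \<omega> (a * b)\<close> on the other edge.\<close>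
    define k where "k z = exp (- (\<i> * complex_of_real \<mu> * z)) * \<omega> (b' * f z)" for z
    have "(\<lambda>z. \<omega> (b' * f (z + 0))) holomorphic_on UNIV"
      by (rule holo[OF f, where C = "norm b'"]) (simp_all add: \<omega>mult aB)
    then have kholo: "k holomorphic_on UNIV"
      unfolding k_def by (intro holomorphic_intros) auto
    have kexp: "k (Complex x y) =
        complex_of_real (exp (\<mu> * y)) * (exp (- (\<i> * complex_of_real (x * \<mu>))) * \<omega> (b' * f (Complex x y)))" for x y
      unfolding k_def split exp_of_real[symmetric]
      by (simp add: algebra_simps flip: exp_add)
    \<comment> \<open>A bound on the compact segment from 0 to \<open>i\<beta>\<close> is enough,
      since \<open>shift\<close> and the isometry of \<alpha> spread it over the strip. This bound
      depends on a' and may grow as \<delta> shrinks, but it only becomes the constant C of the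
      strip lemma, which is absent from its conclusion.\<close>
    have "continuous_on UNIV f"
    proof (rule continuous_at_imp_continuous_on, rule ballI)
      fix z
      obtain d where "(f has_derivative (\<lambda>h. h *\<^sub>C d)) (at z)" using entire_orbitD(2)[OF f] by blast
      then show "isCont f z" by (rule has_derivative_continuous)
    qed
    then have "continuous_on (closed_segment 0 \<beta>) (\<lambda>y. f (\<i> * complex_of_real y))"
      by (rule continuous_on_compose2) (auto intro!: continuous_intros)
    then have "bounded ((\<lambda>y. f (\<i> * complex_of_real y)) ` closed_segment 0 \<beta>)"
      by (intro compact_imp_bounded compact_continuous_image compact_segment)
    then obtain N where N: "\<And>y. y \<in> closed_segment 0 \<beta> \<Longrightarrow> norm (f (\<i> * complex_of_real y)) \<le> N"
      unfolding bounded_iff by auto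
    have est: "norm (u * v - u0 * v0) \<le> \<delta> * M"
      if "norm (u - u0) \<le> \<delta>" "norm (v - v0) \<le> \<delta>"
        "norm u0 \<le> norm a \<and> norm v0 \<le> norm b \<or> norm u0 \<le> norm b \<and> norm v0 \<le> norm a" for u v u0 v0 :: 'a
    proof -
      have "u * v - u0 * v0 = (u - u0) * (v - v0) + u0 * (v - v0) + (u - u0) * v0"
        by (simp add: algebra_simps)
      then have "norm (u * v - u0 * v0) \<le> norm ((u - u0) * (v - v0)) + norm (u0 * (v - v0)) + norm ((u - u0) * v0)"
        using norm_triangle_ineq[of "(u - u0) * (v - v0) + u0 * (v - v0)" "(u - u0) * v0"]
          norm_triangle_ineq[of "(u - u0) * (v - v0)" "u0 * (v - v0)"] by simp
      also have "\<dots> \<le> norm (u - u0) * norm (v - v0) + norm u0 * norm (v - v0) + norm (u - u0) * norm v0"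
        by (intro add_mono norm_mult_ineq)
      also have "\<dots> \<le> \<delta> * 1 + norm u0 * \<delta> + \<delta> * norm v0"
        using that \<delta> by (intro add_mono mult_mono) auto
      also have "\<dots> = \<delta> * (norm u0 + norm v0 + 1)" by (simp add: algebra_simps)
      also have "\<dots> \<le> \<delta> * M"
        using that \<delta> unfolding M_def by (intro mult_left_mono) auto
      finally show ?thesis .
    qed
    have \<alpha>a: "norm (\<alpha> x a' - \<alpha> x a) \<le> \<delta>" "norm (\<alpha> x a) = norm a" "\<alpha> x a' \<in> B" "\<alpha> x a \<in> B" for x
    proof -
      have "\<alpha> x a' - \<alpha> x a = \<alpha> x (a' - a)" using \<alpha>diff aB by simp
      then show "norm (\<alpha> x a' - \<alpha> x a) \<le> \<delta>"
        using one_parameter_groupD(3)[OF \<alpha>, of "a' - a" x] a'(2) aB Bsub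
        by (simp add: complex_vector.subspace_diff)
    qed (simp_all add: \<alpha>D aB)
    \<comment> \<open>The near edge has error \<open>\<delta> * M\<close>, the far edge
      \<open>q * (\<delta> * M)\<close>; the strip lemma takes a single \<epsilon>, and
      \<open>1 + q\<close> covers both.\<close>
    have "cmod (\<omega> (b * a) - complex_of_real q * \<omega> (a * b)) \<le> 2 * ((1 + q) * (\<delta> * M))"
    proof (rule strip_boundary_constants_close[OF kholo, of \<beta> "exp \<bar>\<mu> * \<beta>\<bar> * (norm b' * N)"])
      fix x y assume y: "y \<in> closed_segment 0 \<beta>"
      have "cmod (k (Complex x y)) = exp (\<mu> * y) * cmod (\<omega> (b' * f (Complex x y)))"
        unfolding kexp by (simp add: norm_mult)
      also have "\<omega> (b' * f (Complex x y)) = \<omega> (b' * \<alpha> x (f (\<i> * complex_of_real y)))"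
        unfolding split by (rule shift)
      also have "exp (\<mu> * y) * cmod \<dots> \<le> exp \<bar>\<mu> * \<beta>\<bar> * (norm b' * N)"
      proof (rule mult_mono)
        have "\<bar>\<mu> * y\<bar> \<le> \<bar>\<mu> * \<beta>\<bar>"
          using y by (auto simp: closed_segment_eq_real_ivl abs_mult intro!: mult_left_mono split: if_splits)
        then show "exp (\<mu> * y) \<le> exp \<bar>\<mu> * \<beta>\<bar>" by simp
        have "cmod (\<omega> (b' * \<alpha> x (f (\<i> * complex_of_real y)))) \<le> norm b' * norm (\<alpha> x (f (\<i> * complex_of_real y)))"
          by (intro \<omega>bd aB \<alpha>D fB)
        also have "\<dots> \<le> norm b' * N"
          using N[OF y] one_parameter_groupD(3)[OF \<alpha> fB] by (intro mult_left_mono) auto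
        finally show "cmod (\<omega> (b' * \<alpha> x (f (\<i> * complex_of_real y)))) \<le> norm b' * N" .
      qed auto
      finally show "cmod (k (Complex x y)) \<le> exp \<bar>\<mu> * \<beta>\<bar> * (norm b' * N)" .
    next
      fix x
      let ?e = "exp (- (\<i> * complex_of_real (x * \<mu>)))"
      have e: "cmod ?e = 1" "?e * exp (\<i> * complex_of_real (x * \<mu>)) = 1"
        by (simp, simp flip: exp_add)
      have f0: "f (Complex x 0) = \<alpha> x a'"
        using entire_orbitD(3)[OF f, of x] by (simp add: split)
      have "\<omega> (b * a) = ?e * \<omega> (b * \<alpha> x a)"
        using e(2) scale[OF mult[OF aB(2,1)], of "exp (\<i> * complex_of_real (x * \<mu>))"]
        by (simp add: eig mult_scaleC_right flip: mult.assoc)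
      then have "k (Complex x 0) - \<omega> (b * a) = ?e * \<omega> (b' * \<alpha> x a' - b * \<alpha> x a)"
        unfolding kexp f0
        by (simp add: diff[OF mult[OF aB(4) \<alpha>a(3)] mult[OF aB(2) \<alpha>a(4)]] right_diff_distrib)
      then have "cmod (k (Complex x 0) - \<omega> (b * a)) \<le> norm (b' * \<alpha> x a' - b * \<alpha> x a)"
        using bd mult aB \<alpha>a Bsub e(1) by (simp add: norm_mult complex_vector.subspace_diff)
      also have "\<dots> \<le> \<delta> * M"
        by (rule est) (use \<alpha>a b' in auto)
      also have "\<dots> \<le> (1 + q) * (\<delta> * M)"
        using \<delta> by (simp add: M_def q_def algebra_simps)
      finally show "cmod (k (Complex x 0) - \<omega> (b * a)) \<le> (1 + q) * (\<delta> * M)" .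
      have "\<omega> (a * b) = ?e * \<omega> (\<alpha> x a * b)"
        using e(2) scale[OF mult[OF aB(1,2)], of "exp (\<i> * complex_of_real (x * \<mu>))"]
        by (simp add: eig mult_scaleC_left flip: mult.assoc)
      moreover have "k (Complex x \<beta>) = complex_of_real q * (?e * \<omega> (\<alpha> x a' * b'))"
        using kexp[of x \<beta>] top[of x] by (simp add: split q_def mult.commute[of \<mu> \<beta>])
      ultimately have "k (Complex x \<beta>) - complex_of_real q * \<omega> (a * b) =
          complex_of_real q * (?e * \<omega> (\<alpha> x a' * b' - \<alpha> x a * b))"
        by (simp add: diff[OF mult[OF \<alpha>a(3) aB(4)] mult[OF \<alpha>a(4) aB(2)]] right_diff_distrib)
      then have "cmod (k (Complex x \<beta>) - complex_of_real q * \<omega> (a * b)) \<le> q * norm (\<alpha> x a' * b' - \<alpha> x a * b)"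
        using bd mult aB \<alpha>a Bsub e(1) by (simp add: norm_mult complex_vector.subspace_diff q_def)
      also have "\<dots> \<le> q * (\<delta> * M)"
        by (intro mult_left_mono est) (use \<alpha>a b' in \<open>auto simp: q_def\<close>)
      also have "\<dots> \<le> (1 + q) * (\<delta> * M)"
        using \<delta> by (simp add: M_def q_def algebra_simps)
      finally show "cmod (k (Complex x \<beta>) - complex_of_real q * \<omega> (a * b)) \<le> (1 + q) * (\<delta> * M)" .
    qed
    then show ?thesis by (simp add: algebra_simps)
  qed
  have "cmod (\<omega> (b * a) - complex_of_real q * \<omega> (a * b)) \<le> 0"
  proof (rule ccontr)
    let ?x = "cmod (\<omega> (b * a) - complex_of_real q * \<omega> (a * b))" and ?K = "2 * (1 + q) * M"
    assume "\<not> ?x \<le> 0"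
    then have x: "?x > 0" by simp
    have K: "?K > 0" by (auto simp: q_def M_def add_pos_pos intro!: mult_pos_pos add_nonneg_pos)
    define \<delta> where "\<delta> = min 1 (?x / (2 * ?K))"
    have "\<delta> > 0" "\<delta> \<le> 1" using x K by (auto simp: \<delta>_def)
    then have "?x \<le> \<delta> * ?K" by (rule main)
    also have "\<dots> \<le> ?x / (2 * ?K) * ?K" using K by (intro mult_right_mono) (auto simp: \<delta>_def)
    also have "\<dots> = ?x / 2" using K by (simp add: field_simps)
    finally show False using x by simp
  qed
  then show ?thesis by (simp add: q_def exp_of_real[symmetric])
qed

section \<open>Measures on infinite words\<close>

lemma topspace_word_topology: "topspace (word_topology Y) = {x. \<forall>i. x i \<in> Y}"
  by (auto simp: word_topology_def)

lemma compact_space_word_topology: "finite Y \<Longrightarrow> compact_space (word_topology Y)"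
  by (simp add: word_topology_def compact_space_product_topology compact_space_discrete_topology)

lemma cylinder_subset_topspace: "cylinder Y t \<subseteq> topspace (word_topology Y)"
  by (auto simp: cylinder_def)

lemma cylinder_Nil: "cylinder Y [] = topspace (word_topology Y)"
  by (simp add: cylinder_def)

lemma cylinder_Int:
  assumes "length t \<le> length u"
  shows "cylinder Y t \<inter> cylinder Y u = (if t = take (length t) u then cylinder Y u else {})"
proof (cases "t = take (length t) u")
  case True
  have "cylinder Y u \<subseteq> cylinder Y t"
  proof
    fix x assume x: "x \<in> cylinder Y u"
    have "x i = t ! i" if "i < length t" for i
      using x that assms by (subst True) (simp add: cylinder_def)
    then show "x \<in> cylinder Y t" using x by (simp add: cylinder_def)
  qed
  then show ?thesis using True by auto
next
  case False
  have "x \<notin> cylinder Y u" if x: "x \<in> cylinder Y t" for x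
  proof
    assume u: "x \<in> cylinder Y u"
    have "t = take (length t) u"
      by (rule nth_equalityI) (use x u assms in \<open>auto simp: cylinder_def\<close>)
    with False show False by simp
  qed
  then show ?thesis using False by auto
qed

lemma cylinder_eq_UN_snoc: "cylinder Y t = (\<Union>s\<in>Y. cylinder Y (t @ [s]))"
  by (auto simp: cylinder_def topspace_word_topology nth_append less_Suc_eq)

lemma disjoint_family_cylinder_snoc: "disjoint_family_on (\<lambda>s. cylinder Y (t @ [s])) Y"
proof -
  have "x (length t) = s" if "x \<in> cylinder Y (t @ [s])" for x s
    using that by (simp add: cylinder_def)
  then show ?thesis unfolding disjoint_family_on_def by blast
qed

lemma openin_coordinate:
  assumes "A \<subseteq> Y"
  shows "openin (word_topology Y) {x \<in> topspace (word_topology Y). x i \<in> A}"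
  unfolding word_topology_def
  by (rule openin_continuous_map_preimage[OF continuous_map_product_projection])
     (use assms in auto)

lemma openin_cylinder:
  assumes "set t \<subseteq> Y"
  shows "openin (word_topology Y) (cylinder Y t)"
proof -
  let ?X = "topspace (word_topology Y)"
  have coord: "openin (word_topology Y) {x \<in> ?X. x i \<in> {t ! i}}" if "i < length t" for i
    by (rule openin_coordinate) (use that assms nth_mem in blast)
  \<comment> \<open>An intersection over no indices would be \<open>UNIV\<close> and not the space,
    so the empty word is treated apart.\<close>
  have "openin (word_topology Y) (\<Inter>i\<in>{..<length t}. {x \<in> ?X. x i \<in> {t ! i}})"
    if "t \<noteq> []"
    by (rule openin_Inter) (use that coord in blast)+
  moreover have "cylinder Y t = (\<Inter>i\<in>{..<length t}. {x \<in> ?X. x i \<in> {t ! i}})" if "t \<noteq> []"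
    using that by (auto simp: cylinder_def)
  ultimately show ?thesis by (cases "t = []") (auto simp: cylinder_Nil)
qed

text \<open>A basic open set of the product topology restricts finitely many coordinates; a prefix
  of x that passes all of them gives the cylinder.\<close>

lemma openin_word_topology_cylinder:
  assumes U: "openin (word_topology Y) U" and x: "x \<in> U"
  obtains t where "t \<in> lists Y" "x \<in> cylinder Y t" "cylinder Y t \<subseteq> U"
proof -
  obtain Z where Z: "finite {i. Z i \<noteq> Y}" "x \<in> (\<Pi>\<^sub>E i\<in>UNIV. Z i)" "(\<Pi>\<^sub>E i\<in>UNIV. Z i) \<subseteq> U"
    using U x unfolding word_topology_def openin_product_topology_alt by auto
  obtain n where n: "\<And>i. Z i \<noteq> Y \<Longrightarrow> i < n"
    using Z(1) finite_nat_set_iff_bounded by auto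
  have xY: "x i \<in> Y" for i
    using U x openin_subset topspace_word_topology by blast
  show ?thesis
  proof
    show "map x [0..<n] \<in> lists Y" using xY by auto
    show "x \<in> cylinder Y (map x [0..<n])" using xY by (simp add: cylinder_def topspace_word_topology)
    have "y i \<in> Z i" if "y \<in> cylinder Y (map x [0..<n])" for y i
    proof (cases "i < n")
      case True
      then have "y i = x i" using that by (simp add: cylinder_def)
      then show ?thesis using Z(2) by auto
    next
      case False
      then have "Z i = Y" using n by blast
      then show ?thesis using that by (simp add: cylinder_def topspace_word_topology)
    qed
    then show "cylinder Y (map x [0..<n]) \<subseteq> U" using Z(3) by auto
  qed
qed

lemma space_word_borel: "space (word_borel Y) = topspace (word_topology Y)"
  by (simp add: word_borel_def space_measure_of_conv)

lemma openin_subset_Pow_topspace: "{U. openin T U} \<subseteq> Pow (topspace T)"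
  using openin_subset by blast

lemma sets_word_borel_openin: "openin (word_topology Y) U \<Longrightarrow> U \<in> sets (word_borel Y)"
  unfolding word_borel_def
  by (simp add: sets_measure_of[OF openin_subset_Pow_topspace] sigma_sets.Basic)

lemma sets_word_borel_cylinder: "set t \<subseteq> Y \<Longrightarrow> cylinder Y t \<in> sets (word_borel Y)"
  by (intro sets_word_borel_openin openin_cylinder)

text \<open>An open set is the union of the cylinders inside it, and this union is countable because
  there are only countably many words over Y.\<close>

lemma sets_word_borel_eq_cylinders:
  assumes "finite Y"
  shows "sets (word_borel Y) = sigma_sets (topspace (word_topology Y)) (cylinder Y ` lists Y)"
    (is "_ = sigma_sets ?X ?C")
proof
  have "U \<in> sigma_sets ?X ?C" if U: "openin (word_topology Y) U" for U
  proof -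
    let ?K = "{C \<in> ?C. C \<subseteq> U}"
    have "U = \<Union> ?K"
    proof
      show "U \<subseteq> \<Union> ?K"
      proof
        fix x assume "x \<in> U"
        then obtain t where "t \<in> lists Y" "x \<in> cylinder Y t" "cylinder Y t \<subseteq> U"
          using openin_word_topology_cylinder[OF U] by metis
        then show "x \<in> \<Union> ?K" by blast
      qed
    qed blast
    moreover have "countable ?K"
      by (rule countable_subset[of _ ?C])
         (auto intro!: countable_image countable_lists countable_finite[OF assms])
    moreover have "\<Union> ?K \<in> sigma_sets ?X ?C"
      using calculation(2) by (rule sigma_sets_UNION) (blast intro: sigma_sets.Basic)
    ultimately show ?thesis by simp
  qed
  then show "sets (word_borel Y) \<subseteq> sigma_sets ?X ?C"
    unfolding word_borel_def sets_measure_of[OF openin_subset_Pow_topspace]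
    by (intro sigma_sets_mono) blast
  have "?C \<subseteq> sets (word_borel Y)"
    by (auto intro!: sets_word_borel_cylinder)
  then show "sigma_sets ?X ?C \<subseteq> sets (word_borel Y)"
    by (rule sets.sigma_sets_subset[of _ "word_borel Y", unfolded space_word_borel])
qed

text \<open>Two cylinders are nested or disjoint, so together with the empty set they form an
  intersection-stable generator, and measures agreeing on it coincide.\<close>

lemma word_measure_eqI:
  assumes Y: "finite Y" and m: "prob_space m" "sets m = sets (word_borel Y)"
    and n: "prob_space n" "sets n = sets (word_borel Y)"
    and eq: "\<And>t. t \<in> lists Y \<Longrightarrow> emeasure m (cylinder Y t) = emeasure n (cylinder Y t)"
  shows "m = n"
proof (rule measure_eqI_generator_eq[where E = "insert {} (cylinder Y ` lists Y)"
      and \<Omega> = "topspace (word_topology Y)" and A = "\<lambda>_. topspace (word_topology Y)"])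
  let ?X = "topspace (word_topology Y)" and ?C = "cylinder Y ` lists Y"
  show "Int_stable (insert {} ?C)"
  proof (rule Int_stableI)
    fix a b assume ab: "a \<in> insert {} ?C" "b \<in> insert {} ?C"
    show "a \<inter> b \<in> insert {} ?C"
    proof (cases "a = {} \<or> b = {}")
      case False
      then obtain t u where tu: "t \<in> lists Y" "a = cylinder Y t" "u \<in> lists Y" "b = cylinder Y u"
        using ab by auto
      show ?thesis
        using cylinder_Int[of t u Y] cylinder_Int[of u t Y] tu
        by (cases "length t \<le> length u") (auto simp: Int_commute)
    qed auto
  qed
  show "insert {} ?C \<subseteq> Pow ?X" using cylinder_subset_topspace by auto
  show "emeasure m Z = emeasure n Z" if "Z \<in> insert {} ?C" for Z
    using that eq by auto
  have "sigma_sets ?X (insert {} ?C) = sigma_sets ?X ?C"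
    by (rule sigma_sets_eqI) (auto intro: sigma_sets.Empty)
  then show "sets m = sigma_sets ?X (insert {} ?C)" "sets n = sigma_sets ?X (insert {} ?C)"
    using m n sets_word_borel_eq_cylinders[OF Y] by auto
  show "range (\<lambda>_. ?X) \<subseteq> insert {} ?C" by (auto simp flip: cylinder_Nil)
  show "(\<Union>i. ?X) = ?X" by simp
  show "emeasure m ?X \<noteq> \<infinity>" for i :: nat
    using m(1) by (simp add: prob_space.emeasure_space_1 finite_measure.emeasure_finite prob_space.finite_measure)
qed

section \<open>The Bernoulli measure on infinite words\<close>

lemma sets_bernoulli_measure:
  assumes Y: "finite Y"
  shows "sets (bernoulli_measure Y p) = sets (word_borel Y)"
proof -
  let ?X = "topspace (word_topology Y)"
  have sp: "(\<Pi>\<^sub>E i\<in>UNIV. space (count_space Y)) = ?X"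
    by (auto simp: topspace_word_topology)
  have "sets (bernoulli_measure Y p) = sets (\<Pi>\<^sub>M i\<in>(UNIV::nat set). count_space Y)"
    unfolding bernoulli_measure_def by (intro sets_PiM_cong) (auto simp: sets_point_measure)
  \<comment> \<open>Each side contains the generators of the other: one-coordinate conditions are
    open, and a cylinder is a finite conjunction of one-coordinate conditions.\<close>
  also have "\<dots> = sets (word_borel Y)"
  proof
    have *: "sets (\<Pi>\<^sub>M i\<in>(UNIV::nat set). count_space Y)
        = sigma_sets ?X {{f \<in> ?X. f i \<in> A} | i A. A \<subseteq> Y}"
      unfolding sets_PiM_single sp by simp
    show "sets (\<Pi>\<^sub>M i\<in>(UNIV::nat set). count_space Y) \<subseteq> sets (word_borel Y)"
      unfolding * by (rule sets.sigma_sets_subset[of _ "word_borel Y", unfolded space_word_borel])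
        (auto intro!: sets_word_borel_openin openin_coordinate)
    have X: "space (\<Pi>\<^sub>M i\<in>(UNIV::nat set). count_space Y) = ?X" unfolding space_PiM by (rule sp)
    have "cylinder Y t \<in> sets (\<Pi>\<^sub>M i\<in>(UNIV::nat set). count_space Y)" if "t \<in> lists Y" for t
    proof -
      have "{x \<in> ?X. \<forall>i\<in>{..<length t}. x i = t ! i} \<in> sets (\<Pi>\<^sub>M i\<in>(UNIV::nat set). count_space Y)"
        unfolding X[symmetric]
      proof (rule sets.sets_Collect_finite_All)
        fix i assume i: "i \<in> {..<length t}"
        have "{x \<in> ?X. x i \<in> {t ! i}} \<in> sets (\<Pi>\<^sub>M i\<in>(UNIV::nat set). count_space Y)"
          unfolding * using that i by (intro sigma_sets.Basic) (auto intro!: exI[of _ i] exI[of _ "{t ! i}"])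
        then show "{x \<in> space (\<Pi>\<^sub>M i\<in>(UNIV::nat set). count_space Y). x i = t ! i}
            \<in> sets (\<Pi>\<^sub>M i\<in>(UNIV::nat set). count_space Y)" unfolding X by simp
      qed (rule finite_lessThan)
      then show ?thesis by (simp only: cylinder_def Ball_def lessThan_iff)
    qed
    then have "cylinder Y ` lists Y \<subseteq> sets (\<Pi>\<^sub>M i\<in>(UNIV::nat set). count_space Y)"
      by blast
    from sets.sigma_sets_subset[OF this]
    show "sets (word_borel Y) \<subseteq> sets (\<Pi>\<^sub>M i\<in>(UNIV::nat set). count_space Y)"
      unfolding sets_word_borel_eq_cylinders[OF Y] X .
  qed
  finally show ?thesis .
qed

lemma bernoulli_measure_cylinder:
  assumes Y: "finite Y" and p: "\<And>s. s \<in> Y \<Longrightarrow> p s \<ge> 0" "(\<Sum>s\<in>Y. p s) = 1"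
  shows "prob_space (bernoulli_measure Y p)"
    and "t \<in> lists Y \<Longrightarrow> emeasure (bernoulli_measure Y p) (cylinder Y t) = ennreal (prod_list (map p t))"
proof -
  let ?P = "point_measure Y (\<lambda>s. ennreal (p s))"
  have P: "prob_space ?P"
    using assms by (intro prob_spaceI) (simp add: space_point_measure emeasure_point_measure_finite sum_ennreal)
  interpret product_prob_space "\<lambda>_::nat. ?P" UNIV
    using P by (simp add: product_prob_space_def product_prob_space_axioms_def product_sigma_finite_def
        prob_space_imp_sigma_finite)
  show "prob_space (bernoulli_measure Y p)"
    unfolding bernoulli_measure_def by (rule prob_space_axioms)
  assume t: "t \<in> lists Y"
  have sp: "space (\<Pi>\<^sub>M i\<in>(UNIV::nat set). ?P) = topspace (word_topology Y)"
    by (auto simp: space_PiM space_point_measure topspace_word_topology)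
  have "cylinder Y t = {x \<in> space (\<Pi>\<^sub>M i\<in>(UNIV::nat set). ?P). \<forall>i\<in>{..<length t}. x i \<in> {t ! i}}"
    unfolding sp by (auto simp: cylinder_def)
  then have "emeasure (bernoulli_measure Y p) (cylinder Y t) = (\<Prod>i\<in>{..<length t}. emeasure ?P {t ! i})"
    unfolding bernoulli_measure_def using t
    by (simp only:) (intro emeasure_PiM_Collect, auto simp: sets_point_measure)
  also have "\<dots> = (\<Prod>i\<in>{..<length t}. ennreal (p (t ! i)))"
    using t Y by (intro prod.cong) (auto simp: emeasure_point_measure_finite)
  also have "\<dots> = ennreal (\<Prod>i\<in>{..<length t}. p (t ! i))"
    using t p(1) by (intro prod_ennreal) auto
  also have "(\<Prod>i\<in>{..<length t}. p (t ! i)) = prod_list (map p t)"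
    by (simp add: prod.list_conv_set_nth atLeast0LessThan)
  finally show "emeasure (bernoulli_measure Y p) (cylinder Y t) = ennreal (prod_list (map p t))" .
qed

lemma prod_list_exp_word_sum: "prod_list (map (\<lambda>s. exp (- \<beta> * F s)) t) = exp (- \<beta> * word_sum F t)"
  by (induction t) (simp_all add: word_sum_def algebra_simps flip: exp_add)

section \<open>The Cuntz algebra\<close>

lemma adj_one: "adj 1 = (1::'a::cstar_algebra)"
  by (metis adj_adj adj_mult mult.left_neutral mult.right_neutral)

lemma adj_zero: "adj 0 = (0::'a::cstar_algebra)"
  using adj_scaleC[of 0 "0::'a"] by simp

lemma star_subalgebraD:
  assumes "star_subalgebra A"
  shows "csubspace A" and "a \<in> A \<Longrightarrow> b \<in> A \<Longrightarrow> a * b \<in> A" and "a \<in> A \<Longrightarrow> adj a \<in> A"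
    and "a \<in> A \<Longrightarrow> b \<in> A \<Longrightarrow> a + b \<in> A" and "a \<in> A \<Longrightarrow> c *\<^sub>C a \<in> A" and "0 \<in> A"
  using assms unfolding star_subalgebra_def
  by (auto intro: complex_vector.subspace_add complex_vector.subspace_scale complex_vector.subspace_0)

lemma star_subalgebra_generated: "star_subalgebra (generated_cstar_subalgebra S)"
  unfolding star_subalgebra_def[of "generated_cstar_subalgebra S"] complex_vector.subspace_def
  unfolding generated_cstar_subalgebra_def by (auto dest: star_subalgebraD)

lemma closed_generated_cstar_subalgebra: "closed (generated_cstar_subalgebra S)"
  unfolding generated_cstar_subalgebra_def by (auto intro: closed_Inter)

lemma subset_generated_cstar_subalgebra: "S \<subseteq> generated_cstar_subalgebra S"
  unfolding generated_cstar_subalgebra_def by auto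

lemma word_isometry_simps:
  "word_isometry V [] = 1"
  "word_isometry V (s # t) = V s * word_isometry V t"
  "word_isometry V (t @ u) = word_isometry V t * word_isometry V u"
  by (simp_all add: word_isometry_def)

locale cuntz_setting =
  fixes Y :: "'g set" and V :: "'g \<Rightarrow> 'a::cstar_algebra"
    and E :: "'a \<Rightarrow> 'a" and \<Phi> :: "'a \<Rightarrow> (nat \<Rightarrow> 'g) \<Rightarrow> complex"
  assumes finite_Y: "finite Y" and Y_nonempty: "Y \<noteq> {}"
    and cuntz: "cuntz_family Y V"
    and expectation: "cuntz_expectation Y V E"
    and iso: "diagonal_iso Y V \<Phi>"
begin

abbreviation "\<O> \<equiv> cuntz_algebra Y V"
abbreviation "\<D> \<equiv> cuntz_diagonal Y V"
abbreviation "S \<equiv> word_isometry V"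
abbreviation "X \<equiv> topspace (word_topology Y)"

lemma star_subalgebra_O: "star_subalgebra \<O>" and closed_O: "closed \<O>"
  by (simp_all add: cuntz_algebra_def star_subalgebra_generated closed_generated_cstar_subalgebra)

lemmas O_closed = star_subalgebraD[OF star_subalgebra_O]

lemma star_subalgebra_D: "star_subalgebra \<D>"
  by (simp add: cuntz_diagonal_def star_subalgebra_generated)

lemmas D_closed = star_subalgebraD[OF star_subalgebra_D]

lemma isometry: "s \<in> Y \<Longrightarrow> adj (V s) * V s = 1"
  using cuntz by (simp add: cuntz_family_def)

lemma V_in_O: "s \<in> Y \<Longrightarrow> V s \<in> \<O>"
  using subset_generated_cstar_subalgebra[of "V ` Y"] by (auto simp: cuntz_algebra_def)

text \<open>The generated subalgebra is not unital by definition; the unit arises as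
  \<open>adj (V s) * V s\<close> for some letter s.\<close>

lemma one_in_O: "1 \<in> \<O>"
  using Y_nonempty isometry V_in_O O_closed by (metis all_not_in_conv)

lemma S_in_O: "t \<in> lists Y \<Longrightarrow> S t \<in> \<O>"
  by (induction t) (auto simp: word_isometry_simps one_in_O V_in_O O_closed)

lemma SS_in_O: "t \<in> lists Y \<Longrightarrow> u \<in> lists Y \<Longrightarrow> S t * adj (S u) \<in> \<O>"
  by (intro O_closed S_in_O)

lemma SS_in_D: "t \<in> lists Y \<Longrightarrow> S t * adj (S t) \<in> \<D>"
  using subset_generated_cstar_subalgebra[of "{S t * adj (S t) | t. t \<in> lists Y}"]
  unfolding cuntz_diagonal_def by blast

lemma E_D: "a \<in> \<O> \<Longrightarrow> E a \<in> \<D>"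
  and E_norm: "a \<in> \<O> \<Longrightarrow> norm (E a) \<le> norm a"
  and E_add: "a \<in> \<O> \<Longrightarrow> b \<in> \<O> \<Longrightarrow> E (a + b) = E a + E b"
  and E_scale: "a \<in> \<O> \<Longrightarrow> E (c *\<^sub>C a) = c *\<^sub>C E a"
  and E_pos: "a \<in> \<O> \<Longrightarrow> \<exists>d\<in>\<D>. E (adj a * a) = adj d * d"
  using expectation
  unfolding cuntz_expectation_def conditional_expectation_def clinear_on_set_def by blast+

lemma E_S: "t \<in> lists Y \<Longrightarrow> u \<in> lists Y \<Longrightarrow>
    E (S t * adj (S u)) = (if t = u then S t * adj (S t) else 0)"
  using expectation unfolding cuntz_expectation_def by blast

lemma Phi_cont: "a \<in> \<D> \<Longrightarrow> continuous_map (word_topology Y) euclidean (\<Phi> a)"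
  and Phi_add: "a \<in> \<D> \<Longrightarrow> b \<in> \<D> \<Longrightarrow> x \<in> X \<Longrightarrow> \<Phi> (a + b) x = \<Phi> a x + \<Phi> b x"
  and Phi_scale: "a \<in> \<D> \<Longrightarrow> x \<in> X \<Longrightarrow> \<Phi> (c *\<^sub>C a) x = c * \<Phi> a x"
  and Phi_mult: "a \<in> \<D> \<Longrightarrow> b \<in> \<D> \<Longrightarrow> x \<in> X \<Longrightarrow> \<Phi> (a * b) x = \<Phi> a x * \<Phi> b x"
  and Phi_adj: "a \<in> \<D> \<Longrightarrow> x \<in> X \<Longrightarrow> \<Phi> (adj a) x = cnj (\<Phi> a x)"
  and Phi_norm: "a \<in> \<D> \<Longrightarrow> norm a = (SUP x\<in>X. cmod (\<Phi> a x))"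
  and Phi_S: "t \<in> lists Y \<Longrightarrow> x \<in> X \<Longrightarrow> \<Phi> (S t * adj (S t)) x = indicator (cylinder Y t) x"
  using iso unfolding diagonal_iso_def Let_def by blast+

lemma X_nonempty: "X \<noteq> {}"
  using Y_nonempty by (auto simp: topspace_word_topology)

text \<open>The range projections of \<open>V\<^sub>s\<close> and \<open>V\<^sub>r\<close> multiply to zero because \<open>\<Phi>\<close> maps them to
  indicators of disjoint cylinders; this replaces the usual argument from the positivity of
  \<open>\<Sum>V\<^sub>sV\<^sub>s* = 1\<close>.\<close>

lemma V_orthogonal:
  assumes "s \<in> Y" "r \<in> Y" "s \<noteq> r"
  shows "adj (V s) * V r = 0"
proof -
  let ?P = "\<lambda>s. S [s] * adj (S [s])"
  have P: "?P s \<in> \<D>" "?P r \<in> \<D>" using assms by (auto intro!: SS_in_D)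
  have "\<Phi> (?P s * ?P r) x = 0" if x: "x \<in> X" for x
  proof -
    have "\<Phi> (?P s * ?P r) x = indicator (cylinder Y [s]) x * indicator (cylinder Y [r]) x"
      using Phi_mult[OF P x] Phi_S[of "[s]" x] Phi_S[of "[r]" x] x assms by simp
    also have "\<dots> = 0"
      using assms(3) by (auto simp: indicator_def cylinder_def)
    finally show ?thesis .
  qed
  then have "norm (?P s * ?P r) = 0"
    using Phi_norm[OF D_closed(2)[OF P]] X_nonempty by simp
  then have "V s * adj (V s) * (V r * adj (V r)) = 0"
    by (simp add: word_isometry_simps)
  \<comment> \<open>Compressing the product of the range projections by \<open>adj (V s)\<close> and
    \<open>V r\<close> leaves \<open>adj (V s) * V r\<close>, as both are isometries.\<close>
  then have "adj (V s) * (V s * adj (V s) * (V r * adj (V r))) * V r = 0"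
    by simp
  moreover have "adj (V s) * (V s * adj (V s) * (V r * adj (V r))) * V r
      = (adj (V s) * V s) * adj (V s) * V r * (adj (V r) * V r)"
    by (simp only: mult.assoc)
  ultimately show ?thesis using isometry assms by simp
qed

lemma S_adj_S:
  "t \<in> lists Y \<Longrightarrow> adj (S t) * S (t @ v) = S v"
  "t \<in> lists Y \<Longrightarrow> adj (S (t @ v)) * S t = adj (S v)"
proof -
  have *: "adj (S t) * S t = 1" if "t \<in> lists Y" for t
    using that
  proof (induction t)
    case (Cons s t)
    have "adj (S (s # t)) * S (s # t) = adj (S t) * (adj (V s) * V s) * S t"
      by (simp only: word_isometry_simps adj_mult mult.assoc)
    then show ?case using Cons isometry by simp
  qed (simp add: word_isometry_simps adj_one)
  show "adj (S t) * S (t @ v) = S v" if "t \<in> lists Y"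
    using *[OF that] by (simp add: word_isometry_simps flip: mult.assoc)
  show "adj (S (t @ v)) * S t = adj (S v)" if "t \<in> lists Y"
    using *[OF that] by (simp add: word_isometry_simps adj_mult mult.assoc)
qed

text \<open>Equal leading letters cancel by the isometry relation. Incomparable words differ at some
  common position, where the letters are orthogonal.\<close>

lemma S_orthogonal:
  "t \<in> lists Y \<Longrightarrow> u \<in> lists Y \<Longrightarrow> \<not> prefix t u \<Longrightarrow> \<not> prefix u t \<Longrightarrow> adj (S t) * S u = 0"
proof (induction t arbitrary: u)
  case (Cons s t)
  then obtain r u' where u: "u = r # u'" by (cases u) auto
  have eq: "adj (S (s # t)) * S u = adj (S t) * (adj (V s) * V r) * S u'"
    by (simp only: u word_isometry_simps adj_mult mult.assoc)
  show ?case
  proof (cases "s = r")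
    case True
    then have "adj (S (s # t)) * S u = adj (S t) * S u'" using eq isometry Cons.prems by simp
    also have "\<dots> = 0" using Cons True u by auto
    finally show ?thesis .
  next
    case False
    then show ?thesis using eq V_orthogonal Cons.prems u by simp
  qed
qed simp

text \<open>The inner words u and w are comparable as prefixes or not, so these cases determine
  every product of two spanning elements.\<close>

lemma SS_mult:
  assumes "t \<in> lists Y" "u \<in> lists Y" "w \<in> lists Y" "x \<in> lists Y"
  shows "w = u @ v \<Longrightarrow> (S t * adj (S u)) * (S w * adj (S x)) = S (t @ v) * adj (S x)"
    and "u = w @ v \<Longrightarrow> (S t * adj (S u)) * (S w * adj (S x)) = S t * adj (S (x @ v))"
    and "\<not> prefix u w \<Longrightarrow> \<not> prefix w u \<Longrightarrow> (S t * adj (S u)) * (S w * adj (S x)) = 0"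
proof -
  have eq: "(S t * adj (S u)) * (S w * adj (S x)) = S t * (adj (S u) * S w) * adj (S x)"
    by (simp only: mult.assoc)
  show "w = u @ v \<Longrightarrow> (S t * adj (S u)) * (S w * adj (S x)) = S (t @ v) * adj (S x)"
    using S_adj_S(1)[of u v] assms(2) unfolding eq by (simp add: word_isometry_simps(3))
  show "u = w @ v \<Longrightarrow> (S t * adj (S u)) * (S w * adj (S x)) = S t * adj (S (x @ v))"
    using S_adj_S(2)[of w v] assms(3) unfolding eq
    by (simp add: word_isometry_simps(3) adj_mult mult.assoc)
  show "\<not> prefix u w \<Longrightarrow> \<not> prefix w u \<Longrightarrow> (S t * adj (S u)) * (S w * adj (S x)) = 0"
    using S_orthogonal assms unfolding eq by simp
qed

text \<open>A real supremum bounds its family only when the family is bounded; compactness of the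
  word space, due to the finite alphabet, supplies this.\<close>

lemma Phi_le_norm:
  assumes a: "a \<in> \<D>" and x: "x \<in> X"
  shows "cmod (\<Phi> a x) \<le> norm a"
proof -
  have "compactin (word_topology Y) X"
    using compact_space_word_topology[OF finite_Y] by (simp add: compact_space_def)
  then have "compact (\<Phi> a ` X)"
    using image_compactin[OF _ Phi_cont[OF a]] by simp
  then have "bounded (\<Phi> a ` X)" by (rule compact_imp_bounded)
  then have "bdd_above ((\<lambda>x. cmod (\<Phi> a x)) ` X)"
    unfolding bounded_iff bdd_above_def by auto
  then show ?thesis unfolding Phi_norm[OF a] using x by (rule cSUP_upper[rotated])
qed

end

section \<open>The functional that a probability measure induces on the Cuntz algebra\<close>

locale word_measure = cuntz_setting Y V E \<Phi> + prob_space m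
  for Y :: "'g set" and V :: "'g \<Rightarrow> 'a::cstar_algebra" and E \<Phi> and m :: "(nat \<Rightarrow> 'g) measure" +
  assumes sets_m: "sets m = sets (word_borel Y)"
begin

definition \<omega> :: "'a \<Rightarrow> complex" where
  "\<omega> a = (\<integral>x. \<Phi> (E a) x \<partial>m)"

lemma space_m: "space m = X"
  using sets_eq_imp_space_eq[OF sets_m] by (simp add: space_word_borel)

lemma Phi_measurable: "a \<in> \<D> \<Longrightarrow> \<Phi> a \<in> borel_measurable m"
proof (rule borel_measurableI)
  fix U :: "complex set" assume a: "a \<in> \<D>" and U: "open U"
  have "\<Phi> a -` U \<inter> space m = {x \<in> X. \<Phi> a x \<in> U}" by (auto simp: space_m)
  moreover have "openin (word_topology Y) {x \<in> X. \<Phi> a x \<in> U}"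
    using U by (intro openin_continuous_map_preimage[OF Phi_cont[OF a]]) simp
  ultimately show "\<Phi> a -` U \<inter> space m \<in> sets m"
    by (simp add: sets_m sets_word_borel_openin)
qed

lemma Phi_integrable: "a \<in> \<D> \<Longrightarrow> integrable m (\<Phi> a)"
  by (rule integrable_const_bound[where B = "norm a"])
     (auto intro!: AE_I2 Phi_le_norm Phi_measurable simp: space_m)

lemma \<omega>_add: "a \<in> \<O> \<Longrightarrow> b \<in> \<O> \<Longrightarrow> \<omega> (a + b) = \<omega> a + \<omega> b"
proof -
  assume ab: "a \<in> \<O>" "b \<in> \<O>"
  have "\<omega> (a + b) = (\<integral>x. \<Phi> (E a) x + \<Phi> (E b) x \<partial>m)"
    unfolding \<omega>_def by (rule Bochner_Integration.integral_cong[OF refl]) (simp add: ab E_add E_D Phi_add space_m)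
  also have "\<dots> = \<omega> a + \<omega> b"
    unfolding \<omega>_def by (intro Bochner_Integration.integral_add Phi_integrable E_D ab)
  finally show ?thesis .
qed

lemma \<omega>_scale: "a \<in> \<O> \<Longrightarrow> \<omega> (c *\<^sub>C a) = c * \<omega> a"
proof -
  assume a: "a \<in> \<O>"
  have "\<omega> (c *\<^sub>C a) = (\<integral>x. c * \<Phi> (E a) x \<partial>m)"
    unfolding \<omega>_def by (rule Bochner_Integration.integral_cong[OF refl]) (simp add: a E_scale E_D Phi_scale space_m)
  then show ?thesis by (simp add: \<omega>_def)
qed

text \<open>Both \<open>E\<close> and evaluation of \<Phi> are contractive, and m has mass 1. This
  estimate lets norm approximations pass through \<omega>.\<close>

lemma \<omega>_bound:
  assumes a: "a \<in> \<O>"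
  shows "cmod (\<omega> a) \<le> norm a"
proof -
  have "cmod (\<omega> a) \<le> (\<integral>x. cmod (\<Phi> (E a) x) \<partial>m)"
    unfolding \<omega>_def by (rule integral_norm_bound)
  also have "\<dots> \<le> (\<integral>x. norm a \<partial>m)"
  proof (rule integral_mono)
    show "integrable m (\<lambda>x. cmod (\<Phi> (E a) x))"
      by (intro integrable_norm Phi_integrable E_D a)
    show "cmod (\<Phi> (E a) x) \<le> norm a" if "x \<in> space m" for x
      using Phi_le_norm[OF E_D[OF a], of x] E_norm[OF a] that by (simp add: space_m)
  qed simp
  also have "\<dots> = norm a" by (simp add: prob_space)
  finally show ?thesis .
qed

lemma \<omega>_zero: "\<omega> 0 = 0"
  using \<omega>_bound[OF O_closed(6)] by simp

lemma \<omega>_S: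
  assumes "t \<in> lists Y" "u \<in> lists Y"
  shows "\<omega> (S t * adj (S u)) = (if t = u then complex_of_real (prob (cylinder Y t)) else 0)"
proof (cases "t = u")
  case True
  have "\<omega> (S t * adj (S t)) = (\<integral>x. complex_of_real (indicator (cylinder Y t) x) \<partial>m)"
    unfolding \<omega>_def
    by (rule Bochner_Integration.integral_cong[OF refl])
       (simp add: E_S assms Phi_S space_m indicator_def)
  also have "\<dots> = complex_of_real (prob (cylinder Y t))"
    using cylinder_subset_topspace[of Y t]
    by (simp only: integral_complex_of_real integral_indicator) (simp add: space_m Int_absorb2)
  finally show ?thesis using True by simp
next
  case False
  then have "E (S t * adj (S u)) = E 0"
    using E_S[OF assms] E_scale[OF O_closed(6), of 0] by simp
  then show ?thesis using False \<omega>_zero by (simp add: \<omega>_def)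
qed

text \<open>Positivity of \<open>E\<close> is available in the form \<open>E (a* a) = d* d\<close>,
  which \<Phi> turns into the square of an absolute value.\<close>

lemma \<omega>_pos:
  assumes a: "a \<in> \<O>"
  shows "\<omega> (adj a * a) \<in> \<real>\<^sub>\<ge>\<^sub>0"
proof -
  obtain d where d: "d \<in> \<D>" "E (adj a * a) = adj d * d" using E_pos[OF a] by blast
  have "\<omega> (adj a * a) = (\<integral>x. complex_of_real ((cmod (\<Phi> d x))\<^sup>2) \<partial>m)"
    unfolding \<omega>_def d(2)
  proof (rule Bochner_Integration.integral_cong[OF refl])
    fix x assume "x \<in> space m"
    then show "\<Phi> (adj d * d) x = complex_of_real ((cmod (\<Phi> d x))\<^sup>2)"
      using d(1) by (simp add: space_m Phi_mult Phi_adj D_closed complex_norm_square mult.commute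
          del: of_real_power)
  qed
  also have "\<dots> = complex_of_real (\<integral>x. (cmod (\<Phi> d x))\<^sup>2 \<partial>m)"
    by (rule integral_complex_of_real)
  also have "\<dots> \<in> \<real>\<^sub>\<ge>\<^sub>0"
    by (simp add: integral_nonneg_AE)
  finally show ?thesis .
qed

lemma \<omega>_one: "\<omega> 1 = 1"
  using \<omega>_S[of "[]" "[]"] prob_space
  by (simp add: word_isometry_simps adj_one cylinder_Nil space_m)

lemma prob_cylinder_snoc:
  assumes t: "t \<in> lists Y"
  shows "prob (cylinder Y t) = (\<Sum>s\<in>Y. prob (cylinder Y (t @ [s])))"
  unfolding cylinder_eq_UN_snoc[of Y t]
proof (rule finite_measure_finite_Union[OF finite_Y])
  show "(\<lambda>s. cylinder Y (t @ [s])) ` Y \<subseteq> sets m"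
    using t by (auto simp: sets_m intro!: sets_word_borel_cylinder)
  show "disjoint_family_on (\<lambda>s. cylinder Y (t @ [s])) Y" by (rule disjoint_family_cylinder_snoc)
qed

end

section \<open>From a KMS measure to its values on cylinders\<close>

locale cuntz_kms = word_measure Y V E \<Phi> m + group G
  for G :: "('g, 'b) monoid_scheme" (structure) and Y :: "'g set" and V :: "'g \<Rightarrow> 'a::cstar_algebra"
    and E \<Phi> and m :: "(nat \<Rightarrow> 'g) measure" +
  fixes F :: "'g \<Rightarrow> real" and \<alpha> :: "real \<Rightarrow> 'a \<Rightarrow> 'a" and \<beta> :: real
  assumes Y_carrier: "Y \<subseteq> carrier G" and dynamics: "cuntz_dynamics Y V F \<alpha>"
begin

abbreviation "\<A> \<equiv> cuntz_group_algebra G Y V"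

definition generators :: "'a set" where
  "generators = {S t * adj (S u) | t u. t \<in> lists Y \<and> u \<in> lists Y \<and> word_prod G t = word_prod G u}"

abbreviation "\<A>\<^sub>0 \<equiv> cspan generators"

lemma A_eq: "\<A> = closure \<A>\<^sub>0"
  by (simp add: cuntz_group_algebra_def generators_def)

lemma generatorE:
  assumes "g \<in> generators"
  obtains t u where "g = S t * adj (S u)" "t \<in> lists Y" "u \<in> lists Y" "word_prod G t = word_prod G u"
  using assms unfolding generators_def by blast

lemma generatorI:
  "t \<in> lists Y \<Longrightarrow> u \<in> lists Y \<Longrightarrow> word_prod G t = word_prod G u \<Longrightarrow> S t * adj (S u) \<in> generators"
  unfolding generators_def by blast

lemma A0_subset_O: "\<A>\<^sub>0 \<subseteq> \<O>"
  by (rule complex_vector.span_minimal[OF _ O_closed(1)]) (auto elim: generatorE intro: SS_in_O)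

lemma A_subset_O: "\<A> \<subseteq> \<O>"
  unfolding A_eq by (rule closure_minimal[OF A0_subset_O closed_O])

lemma \<alpha>_group: "one_parameter_group \<O> \<alpha>"
  using dynamics by (simp add: cuntz_dynamics_def)

lemma \<alpha>_S: "w \<in> lists Y \<Longrightarrow> u \<in> lists Y \<Longrightarrow> \<alpha> r (S w * adj (S u))
    = exp (\<i> * complex_of_real (r * (word_sum F w - word_sum F u))) *\<^sub>C (S w * adj (S u))"
  using dynamics by (simp add: cuntz_dynamics_def)

lemma word_prod_append_lists:
  "t \<in> lists Y \<Longrightarrow> u \<in> lists Y \<Longrightarrow> word_prod G (t @ u) = word_prod G t \<otimes> word_prod G u"
  using Y_carrier by (intro word_prod_append) auto

lemma word_prod_closed_lists: "t \<in> lists Y \<Longrightarrow> word_prod G t \<in> carrier G"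
  using Y_carrier by (intro word_prod_closed) auto

lemma kms_cylinder:
  assumes kms: "kms_state \<A> \<alpha> \<beta> \<omega>" and t: "t \<in> lists Y" and u: "u \<in> lists Y"
    and eq: "word_prod G t = word_prod G u"
  shows "exp (\<beta> * word_sum F t) * prob (cylinder Y t) = exp (\<beta> * word_sum F u) * prob (cylinder Y u)"
proof -
  let ?a = "S t * adj (S u)" and ?b = "S u * adj (S t)"
  have ab: "?a \<in> \<A>" "?b \<in> \<A>"
    unfolding A_eq using closure_subset generatorI t u eq complex_vector.span_base
    by (metis subsetD)+
  \<comment> \<open>The ambient algebra is the full Cuntz algebra, where \<alpha> is given as a
    one-parameter group and \<omega> is bounded; the KMS property refers to the subalgebra \<A>
    inside it.\<close>
  have "\<omega> (?b * ?a) = exp (complex_of_real (\<beta> * (word_sum F t - word_sum F u))) * \<omega> (?a * ?b)"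
    by (rule kms_eigenvector[OF star_subalgebra_O closed_O \<omega>_add \<omega>_scale \<omega>_bound \<alpha>_group A_subset_O kms ab \<alpha>_S])
       (use t u in auto)
  moreover have "?b * ?a = S u * adj (S u)" "?a * ?b = S t * adj (S t)"
    using SS_mult(1)[of u t t u "[]"] SS_mult(1)[of t u u t "[]"] t u by auto
  ultimately have "complex_of_real (prob (cylinder Y u))
      = complex_of_real (exp (\<beta> * (word_sum F t - word_sum F u)) * prob (cylinder Y t))"
    using t u by (simp add: \<omega>_S exp_of_real[symmetric])
  then have "prob (cylinder Y u) = exp (\<beta> * (word_sum F t - word_sum F u)) * prob (cylinder Y t)"
    by (simp only: of_real_eq_iff)
  then show ?thesis
    by (simp add: right_diff_distrib exp_diff)
qed

lemma kms_measure_cylinder: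
  assumes kms: "kms_state \<A> \<alpha> \<beta> \<omega>" and gen: "semigroup_generates G Y"
    and fin: "finite (carrier G)"
  shows "(\<Sum>s\<in>Y. exp (- \<beta> * F s)) = 1"
    and "t \<in> lists Y \<Longrightarrow> prob (cylinder Y t) = exp (- \<beta> * word_sum F t)"
proof -
  \<comment> \<open>An arbitrary word for each group element; by the preceding lemma the function
    \<psi> built from it does not depend on the choice.\<close>
  define \<tau> where "\<tau> g = (SOME t. t \<in> lists Y \<and> word_prod G t = g)" for g
  have \<tau>: "\<tau> g \<in> lists Y \<and> word_prod G (\<tau> g) = g" if "g \<in> carrier G" for g
    unfolding \<tau>_def by (rule someI_ex) (use gen that in \<open>auto simp: semigroup_generates_def\<close>)
  define \<psi> where "\<psi> g = exp (\<beta> * word_sum F (\<tau> g)) * prob (cylinder Y (\<tau> g))" for g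
  have \<psi>: "\<psi> (word_prod G t) = exp (\<beta> * word_sum F t) * prob (cylinder Y t)" if "t \<in> lists Y" for t
    unfolding \<psi>_def using \<tau>[OF word_prod_closed_lists[OF that]] that by (intro kms_cylinder[OF kms]) auto
  have "(\<Sum>s\<in>Y. exp (- \<beta> * F s)) = 1 \<and> (\<forall>g\<in>carrier G. \<psi> g = 1)"
  proof (rule harmonic_on_finite_group_constant[OF fin Y_carrier gen])
    \<comment> \<open>The word chosen for the neutral element may be nonempty, but \<psi> can be
      evaluated at the empty word, whose cylinder is the whole space.\<close>
    show "\<psi> \<one> = 1"
      using \<psi>[of "[]"] prob_space by (simp add: word_prod_def word_sum_def cylinder_Nil space_m)
    fix g assume g: "g \<in> carrier G"
    show "\<psi> g \<ge> 0" by (simp add: \<psi>_def)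
    have t: "\<tau> g \<in> lists Y" "word_prod G (\<tau> g) = g" using \<tau>[OF g] by auto
    have "\<psi> g = exp (\<beta> * word_sum F (\<tau> g)) * (\<Sum>s\<in>Y. prob (cylinder Y (\<tau> g @ [s])))"
      unfolding \<psi>_def prob_cylinder_snoc[OF t(1)] ..
    also have "\<dots> = (\<Sum>s\<in>Y. exp (- \<beta> * F s) * \<psi> (g \<otimes> s))"
      unfolding sum_distrib_left
    proof (rule sum.cong[OF refl])
      fix s assume s: "s \<in> Y"
      have "g \<otimes> s = word_prod G (\<tau> g @ [s])"
        using t s Y_carrier word_prod_append_lists[OF t(1), of "[s]"] by (auto simp: word_prod_def)
      then have "\<psi> (g \<otimes> s) = exp (\<beta> * word_sum F (\<tau> g) + \<beta> * F s) * prob (cylinder Y (\<tau> g @ [s]))"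
        using \<psi>[of "\<tau> g @ [s]"] t s by (simp add: word_sum_def distrib_left)
      then show "exp (\<beta> * word_sum F (\<tau> g)) * prob (cylinder Y (\<tau> g @ [s])) = exp (- \<beta> * F s) * \<psi> (g \<otimes> s)"
        by (simp add: exp_add exp_minus)
    qed
    finally show "\<psi> g = (\<Sum>s\<in>Y. exp (- \<beta> * F s) * \<psi> (g \<otimes> s))" .
  qed simp
  then show "(\<Sum>s\<in>Y. exp (- \<beta> * F s)) = 1"
    and "t \<in> lists Y \<Longrightarrow> prob (cylinder Y t) = exp (- \<beta> * word_sum F t)"
    using \<psi>[of t] word_prod_closed_lists[of t] by (auto simp: exp_minus field_simps)
qed

section \<open>From the cylinder values of the Bernoulli measure back to a KMS state\<close>

lemma star_subalgebra_A0: "star_subalgebra \<A>\<^sub>0"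
proof -
  \<comment> \<open>A product of generators is zero or a generator. If \<open>w = u @ v\<close>,
    then in G the word \<open>t @ v\<close> equals \<open>u @ v = w\<close>, hence x; the other
    comparable case is symmetric.\<close>
  have gg: "g * h \<in> \<A>\<^sub>0" if gh: "g \<in> generators" "h \<in> generators" for g h
  proof -
    obtain t u where g: "g = S t * adj (S u)" "t \<in> lists Y" "u \<in> lists Y" "word_prod G t = word_prod G u"
      using gh(1) by (rule generatorE)
    obtain w x where h: "h = S w * adj (S x)" "w \<in> lists Y" "x \<in> lists Y" "word_prod G w = word_prod G x"
      using gh(2) by (rule generatorE)
    consider v where "w = u @ v" | v where "u = w @ v" | "\<not> prefix u w" "\<not> prefix w u"
      unfolding prefix_def by blast
    then show ?thesis
    proof cases
      case 1
      then have v: "v \<in> lists Y" using h(2) by simp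
      then have "S (t @ v) * adj (S x) \<in> generators"
        using g h 1 by (intro generatorI) (auto simp: word_prod_append_lists)
      then show ?thesis using SS_mult(1)[OF g(2,3) h(2,3) 1] g(1) h(1)
        by (simp add: complex_vector.span_base)
    next
      case 2
      then have v: "v \<in> lists Y" using g(3) by simp
      then have "S t * adj (S (x @ v)) \<in> generators"
        using g h 2 by (intro generatorI) (auto simp: word_prod_append_lists)
      then show ?thesis using SS_mult(2)[OF g(2,3) h(2,3) 2] g(1) h(1)
        by (simp add: complex_vector.span_base)
    next
      case 3
      then show ?thesis using SS_mult(3)[OF g(2,3) h(2,3)] g(1) h(1)
        by (simp add: complex_vector.span_zero)
    qed
  qed
  have ga: "g * b \<in> \<A>\<^sub>0" if "g \<in> generators" "b \<in> \<A>\<^sub>0" for g b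
    using that(2)
    by (induction rule: complex_vector.span_induct_alt)
       (auto simp: distrib_left mult_scaleC_right complex_vector.span_zero
          intro!: complex_vector.span_add complex_vector.span_scale gg that(1))
  have "a * b \<in> \<A>\<^sub>0" if "a \<in> \<A>\<^sub>0" "b \<in> \<A>\<^sub>0" for a b
    using that(1)
    by (induction rule: complex_vector.span_induct_alt)
       (auto simp: distrib_right mult_scaleC_left complex_vector.span_zero
          intro!: complex_vector.span_add complex_vector.span_scale ga that(2))
  moreover have "adj a \<in> \<A>\<^sub>0" if "a \<in> \<A>\<^sub>0" for a
    using that
  proof (induction rule: complex_vector.span_induct_alt)
    case base
    then show ?case by (simp add: adj_zero complex_vector.span_zero)
  next
    case (step c g y)
    from step(1) have "adj g \<in> generators"
      by (elim generatorE) (auto simp: adj_mult adj_adj intro: generatorI)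
    then show ?case using step
      by (simp add: adj_add adj_scaleC complex_vector.span_add complex_vector.span_scale complex_vector.span_base)
  qed
  ultimately show ?thesis
    by (simp add: star_subalgebra_def complex_vector.subspace_span)
qed

text \<open>Both products have nonzero value under the same condition: for some v,
  \<open>w = u @ v\<close> and \<open>x = t @ v\<close>, or \<open>u = w @ v\<close> and
  \<open>t = x @ v\<close>. The two values are then the weights of x and w, or of t and u, and in
  either case the difference of the word sums is \<open>F(t) - F(u)\<close>.\<close>

lemma generators_kms_condition:
  assumes p: "\<And>t. t \<in> lists Y \<Longrightarrow> prob (cylinder Y t) = exp (- \<beta> * word_sum F t)"
    and tuwx: "t \<in> lists Y" "u \<in> lists Y" "w \<in> lists Y" "x \<in> lists Y"
  shows "\<omega> ((S t * adj (S u)) * (S w * adj (S x)))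
    = complex_of_real (exp (- \<beta> * (word_sum F t - word_sum F u))) * \<omega> ((S w * adj (S x)) * (S t * adj (S u)))"
proof -
  have sum_append: "word_sum F (y @ z) = word_sum F y + word_sum F z" for y z
    by (simp add: word_sum_def)
  \<comment> \<open>The two conditions overlap only for empty v, where \<open>x = t\<close> and the
    values agree. This matters below, since exchanging the factors exchanges the order of the
    cases.\<close>
  have val: "\<omega> ((S t * adj (S u)) * (S w * adj (S x))) = complex_of_real
      (if (\<exists>v. w = u @ v \<and> x = t @ v) then exp (- \<beta> * word_sum F x)
       else if (\<exists>v. u = w @ v \<and> t = x @ v) then exp (- \<beta> * word_sum F t) else 0)"
    if "t \<in> lists Y" "u \<in> lists Y" "w \<in> lists Y" "x \<in> lists Y" for t u w x
  proof -
    consider v where "w = u @ v" | v where "u = w @ v" "\<not> prefix u w" | "\<not> prefix u w" "\<not> prefix w u"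
      unfolding prefix_def by blast
    then show ?thesis
    proof cases
      case 1
      then have tv: "t @ v \<in> lists Y" using that by simp
      have "\<omega> ((S t * adj (S u)) * (S w * adj (S x)))
          = complex_of_real (if x = t @ v then exp (- \<beta> * word_sum F x) else 0)"
        unfolding SS_mult(1)[OF that 1] \<omega>_S[OF tv that(4)] p[OF tv] by auto
      moreover have "\<not> (\<exists>v'. u = w @ v' \<and> t = x @ v')" if "x \<noteq> t @ v"
        using 1 that by auto
      ultimately show ?thesis using 1 by auto
    next
      case 2
      then have xv: "x @ v \<in> lists Y" using that by simp
      have "\<omega> ((S t * adj (S u)) * (S w * adj (S x)))
          = complex_of_real (if t = x @ v then exp (- \<beta> * word_sum F t) else 0)"
        unfolding SS_mult(2)[OF that 2(1)] \<omega>_S[OF that(1) xv] p[OF that(1)] by auto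
      moreover
      have "\<not> (\<exists>v'. w = u @ v' \<and> x = t @ v')" using 2(2) by (auto simp: prefix_def)
      ultimately show ?thesis using 2(1) by auto
    next
      case 3
      then show ?thesis unfolding SS_mult(3)[OF that 3] by (auto simp: \<omega>_zero prefix_def)
    qed
  qed
  show ?thesis
    unfolding val[OF tuwx] val[OF tuwx(3,4,1,2)] of_real_mult[symmetric] of_real_eq_iff
    by (auto simp: sum_append algebra_simps simp flip: exp_add)
qed

text \<open>An element of the span has no unique expression in the generators, so the entire
  function is not defined by a formula but built along the span induction, together with all its
  properties.\<close>

lemma A0_entire_orbit:
  assumes p: "\<And>t. t \<in> lists Y \<Longrightarrow> prob (cylinder Y t) = exp (- \<beta> * word_sum F t)"
    and a: "a \<in> \<A>\<^sub>0"
  shows "\<exists>f. range f \<subseteq> \<A>\<^sub>0 \<and> (\<forall>z. \<exists>d. (f has_derivative (\<lambda>h. h *\<^sub>C d)) (at z))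
      \<and> (\<forall>r. f (complex_of_real r) = \<alpha> r a)
      \<and> (\<forall>b\<in>\<A>\<^sub>0. \<omega> (a * b) = \<omega> (b * f (\<i> * complex_of_real \<beta>)))"
    (is "\<exists>f. ?P a f")
proof -
  \<comment> \<open>Membership is part of the claim because the induction rule does not supply it
    for the remainder y, while linearity of \<alpha> and \<omega> is known only inside the Cuntz
    algebra.\<close>
  have "a \<in> \<A>\<^sub>0 \<and> (\<exists>f. ?P a f)"
    using a
  proof (induction rule: complex_vector.span_induct_alt)
    case base
    have "\<alpha> r 0 = 0" for r
      using one_parameter_groupD(5)[OF \<alpha>_group O_closed(6), of r 0] by simp
    then have "?P 0 (\<lambda>_. 0)"
      by (auto simp: complex_vector.span_zero intro!: exI[of _ 0])
    then show ?case using complex_vector.span_zero by blast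
  next
    case (step c g y)
    obtain t u where g: "g = S t * adj (S u)" "t \<in> lists Y" "u \<in> lists Y"
      using generatorE[OF step(1)] by metis
    obtain fy where fy: "?P y fy" using step(2) by blast
    let ?\<mu> = "word_sum F t - word_sum F u"
    \<comment> \<open>The generator g is an eigenvector with \<open>exp (i r \<mu>)\<close>,
      continued by replacing r with z. At \<open>z = i\<beta>\<close> this becomes
      \<open>exp (-\<beta>\<mu>)\<close>, the factor of the KMS condition for generators.\<close>
    define f where "f z = (c * exp (\<i> * z * complex_of_real ?\<mu>)) *\<^sub>C g + fy z" for z
    have gO: "g \<in> \<O>" "g \<in> \<A>\<^sub>0" using g SS_in_O step(1) by (auto intro: complex_vector.span_base)
    have yO: "y \<in> \<O>" using step(2) A0_subset_O by auto
    have "?P (c *\<^sub>C g + y) f"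
    proof (intro conjI allI ballI)
      show "range f \<subseteq> \<A>\<^sub>0"
        using fy gO by (auto simp: f_def intro!: complex_vector.span_add complex_vector.span_scale)
    next
      fix z
      obtain d where d: "(fy has_derivative (\<lambda>h. h *\<^sub>C d)) (at z)" using fy by blast
      have lin: "bounded_linear (\<lambda>c. c *\<^sub>C g)"
        by (rule bounded_linear_intro[where K = "norm g"])
           (simp_all add: scaleC_add_left scaleR_scaleC scaleC_scaleC norm_scaleC scaleR_conv_of_real)
      let ?e' = "c * (exp (\<i> * z * complex_of_real ?\<mu>) * (\<i> * complex_of_real ?\<mu>))"
      have "((\<lambda>z. c * exp (\<i> * z * complex_of_real ?\<mu>)) has_field_derivative ?e') (at z)"
        by (auto intro!: derivative_eq_intros)
      then have "((\<lambda>z. c * exp (\<i> * z * complex_of_real ?\<mu>)) has_derivative (\<lambda>h. ?e' * h)) (at z)"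
        by (simp add: has_field_derivative_def)
      from has_derivative_add[OF bounded_linear.has_derivative[OF lin this] d]
      have "(f has_derivative (\<lambda>h. (?e' * h) *\<^sub>C g + h *\<^sub>C d)) (at z)"
        by (simp add: f_def[abs_def])
      also have "(\<lambda>h. (?e' * h) *\<^sub>C g + h *\<^sub>C d) = (\<lambda>h. h *\<^sub>C (?e' *\<^sub>C g + d))"
        by (simp add: scaleC_add_right scaleC_scaleC mult.commute)
      finally show "\<exists>d. (f has_derivative (\<lambda>h. h *\<^sub>C d)) (at z)" by blast
    next
      fix r
      have "\<alpha> r (c *\<^sub>C g + y) = c *\<^sub>C \<alpha> r g + \<alpha> r y"
        using one_parameter_groupD(4,5)[OF \<alpha>_group] gO yO O_closed(5) by simp
      then show "f (complex_of_real r) = \<alpha> r (c *\<^sub>C g + y)"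
        using fy \<alpha>_S[OF g(2,3), of r] by (simp add: f_def g(1) scaleC_scaleC mult.assoc)
    next
      fix b assume b: "b \<in> \<A>\<^sub>0"
      let ?q = "complex_of_real (exp (- \<beta> * ?\<mu>))"
      have bO: "b \<in> \<O>" using b A0_subset_O by auto
      have fyO: "fy z \<in> \<O>" for z using fy A0_subset_O by blast
      have gb: "b \<in> \<A>\<^sub>0 \<and> \<omega> (g * b) = ?q * \<omega> (b * g)"
        using b
      proof (induction rule: complex_vector.span_induct_alt)
        case base
        then show ?case by (simp add: \<omega>_zero complex_vector.span_zero)
      next
        case (step c' h z)
        obtain w x where h: "h = S w * adj (S x)" "w \<in> lists Y" "x \<in> lists Y"
          using generatorE[OF step(1)] by metis
        have O: "h \<in> \<O>" "z \<in> \<O>" using h step(2) SS_in_O A0_subset_O by auto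
        have "c' *\<^sub>C h + z \<in> \<A>\<^sub>0"
          using step by (simp add: complex_vector.span_add complex_vector.span_scale complex_vector.span_base)
        moreover
        have "\<omega> (g * h) = ?q * \<omega> (h * g)"
          unfolding g(1) h(1) by (rule generators_kms_condition[OF p g(2,3) h(2,3)])
        moreover have "\<omega> (g * (c' *\<^sub>C h + z)) = c' * \<omega> (g * h) + \<omega> (g * z)"
          using O gO O_closed by (simp add: distrib_left mult_scaleC_right \<omega>_add \<omega>_scale)
        moreover have "\<omega> ((c' *\<^sub>C h + z) * g) = c' * \<omega> (h * g) + \<omega> (z * g)"
          using O gO O_closed by (simp add: distrib_right mult_scaleC_left \<omega>_add \<omega>_scale)
        ultimately show ?case using step(2) by (simp add: algebra_simps)
      qed
      have "exp (\<i> * (\<i> * complex_of_real \<beta>) * complex_of_real ?\<mu>) = ?q"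
        by (simp flip: exp_of_real mult.assoc)
      then have "f (\<i> * complex_of_real \<beta>) = (c * ?q) *\<^sub>C g + fy (\<i> * complex_of_real \<beta>)"
        by (simp add: f_def)
      then have "\<omega> (b * f (\<i> * complex_of_real \<beta>)) = c * ?q * \<omega> (b * g) + \<omega> (b * fy (\<i> * complex_of_real \<beta>))"
        using bO gO(1) fyO O_closed by (simp add: distrib_left mult_scaleC_right \<omega>_add \<omega>_scale)
      also have "\<dots> = c * \<omega> (g * b) + \<omega> (y * b)"
        using fy b gb by simp
      also have "\<dots> = \<omega> ((c *\<^sub>C g + y) * b)"
        using bO gO(1) yO O_closed by (simp add: distrib_right mult_scaleC_left \<omega>_add \<omega>_scale)
      finally show "\<omega> ((c *\<^sub>C g + y) * b) = \<omega> (b * f (\<i> * complex_of_real \<beta>))" by simp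
    qed
    moreover have "c *\<^sub>C g + y \<in> \<A>\<^sub>0"
      using step(2) gO(2) by (simp add: complex_vector.span_add complex_vector.span_scale)
    ultimately show ?case by blast
  qed
  then show ?thesis ..
qed

lemma kms_state_if_cylinders:
  assumes p: "\<And>t. t \<in> lists Y \<Longrightarrow> prob (cylinder Y t) = exp (- \<beta> * word_sum F t)"
  shows "kms_state \<A> \<alpha> \<beta> \<omega>"
  unfolding kms_state_def
proof (intro conjI exI)
  show "state_on \<A> \<omega>"
    unfolding state_on_def using A_subset_O
    by (auto simp: \<omega>_one intro!: \<omega>_add \<omega>_scale \<omega>_pos)
  show "star_subalgebra \<A>\<^sub>0" by (rule star_subalgebra_A0)
  show sub: "\<A>\<^sub>0 \<subseteq> \<A>" unfolding A_eq by (rule closure_subset)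
  show "\<A> \<subseteq> closure \<A>\<^sub>0" by (simp add: A_eq)
  \<comment> \<open>Invariance comes from the orbit: \<open>\<alpha> r a\<close> is a value of an
    entire function with range in \<open>\<A>\<^sub>0\<close>.\<close>
  show "\<forall>r. \<alpha> r ` \<A>\<^sub>0 \<subseteq> \<A>\<^sub>0"
  proof (intro allI image_subsetI)
    fix r a assume "a \<in> \<A>\<^sub>0"
    then obtain f where "range f \<subseteq> \<A>\<^sub>0" "f (complex_of_real r) = \<alpha> r a"
      using A0_entire_orbit[OF p] by blast
    then show "\<alpha> r a \<in> \<A>\<^sub>0" by (metis rangeI subsetD)
  qed
  show "\<forall>a\<in>\<A>\<^sub>0. \<exists>f. entire_orbit \<A> \<alpha> a f \<and> (\<forall>b\<in>\<A>\<^sub>0. \<omega> (a * b) = \<omega> (b * f (\<i> * complex_of_real \<beta>)))"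
  proof
    fix a assume "a \<in> \<A>\<^sub>0"
    from A0_entire_orbit[OF p this] sub
    show "\<exists>f. entire_orbit \<A> \<alpha> a f \<and> (\<forall>b\<in>\<A>\<^sub>0. \<omega> (a * b) = \<omega> (b * f (\<i> * complex_of_real \<beta>)))"
      unfolding entire_orbit_def by (meson order_trans)
  qed
qed

end

section \<open>Existence, uniqueness and form of the KMS measure\<close>

theorem corollary4p7:
  fixes G :: "('g, 'b) monoid_scheme"
    and Y :: "'g set"
    and F :: "'g \<Rightarrow> real"
    and \<beta> :: real
    and V :: "'g \<Rightarrow> 'a::cstar_algebra"
    and \<alpha> :: "real \<Rightarrow> 'a \<Rightarrow> 'a"
    and E :: "'a \<Rightarrow> 'a"
    and \<Phi> :: "'a \<Rightarrow> (nat \<Rightarrow> 'g) \<Rightarrow> complex"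
  assumes "group G"
    and "Y \<subseteq> carrier G" and "finite Y" and "card Y \<ge> 2" and "semigroup_generates G Y"
    and "cuntz_family Y V"
    and "cuntz_dynamics Y V F \<alpha>"
    and "cuntz_expectation Y V E"
    and "diagonal_iso Y V \<Phi>"
    and "nilpotent_group G"
    and "trivial_group (abelianization G) \<or> finite (carrier (abelianization G))"
  shows "((\<exists>m. kms_measure G Y V \<alpha> E \<Phi> \<beta> m) \<longleftrightarrow> (\<Sum>s\<in>Y. exp (- \<beta> * F s)) = 1)
    \<and> ((\<exists>m. kms_measure G Y V \<alpha> E \<Phi> \<beta> m) \<longrightarrow>
         (\<exists>!m. kms_measure G Y V \<alpha> E \<Phi> \<beta> m)
         \<and> (\<forall>m. kms_measure G Y V \<alpha> E \<Phi> \<beta> m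
              \<longrightarrow> m = bernoulli_measure Y (\<lambda>s. exp (- \<beta> * F s))))"
proof -
  let ?p = "\<lambda>s. exp (- \<beta> * F s)"
  have "finite (carrier (abelianization G))"
    using assms(11) by (auto simp: trivial_group_def)
  then have fin: "finite (carrier G)"
    using nilpotent_group_finite_if_finite_abelianization assms(10) by blast
  \<comment> \<open>Stated for any Borel probability measure, because it is instantiated twice: with
    a given KMS measure, and with the Bernoulli measure.\<close>
  have setting: "cuntz_kms G Y V E \<Phi> m F \<alpha>"
    if "prob_space m" "sets m = sets (word_borel Y)" for m
    using assms that
    by (auto simp: cuntz_kms_def cuntz_kms_axioms_def word_measure_def word_measure_axioms_def
        cuntz_setting_def)
  have 1: "sum ?p Y = 1 \<and> m = bernoulli_measure Y ?p" if m: "kms_measure G Y V \<alpha> E \<Phi> \<beta> m" for m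
  proof -
    have pm: "prob_space m" "sets m = sets (word_borel Y)" using m by (auto simp: kms_measure_def)
    interpret cuntz_kms G Y V E \<Phi> m F \<alpha> \<beta> by (rule setting[OF pm])
    have kms: "kms_state \<A> \<alpha> \<beta> \<omega>"
      using m by (simp add: kms_measure_def \<omega>_def[abs_def])
    note cyl = kms_measure_cylinder[OF kms assms(5) fin]
    have "m = bernoulli_measure Y ?p"
    proof (rule word_measure_eqI[OF assms(3) pm])
      fix t assume t: "t \<in> lists Y"
      have "emeasure m (cylinder Y t) = ennreal (prod_list (map ?p t))"
        unfolding emeasure_eq_measure cyl(2)[OF t] prod_list_exp_word_sum ..
      also have "\<dots> = emeasure (bernoulli_measure Y ?p) (cylinder Y t)"
        by (rule bernoulli_measure_cylinder(2)[OF assms(3) _ cyl(1) t, symmetric]) simp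
      finally show "emeasure m (cylinder Y t) = emeasure (bernoulli_measure Y ?p) (cylinder Y t)" .
    qed (use bernoulli_measure_cylinder(1)[OF assms(3) _ cyl(1)] sets_bernoulli_measure[OF assms(3)] in auto)
    then show ?thesis using cyl(1) by simp
  qed
  have 2: "kms_measure G Y V \<alpha> E \<Phi> \<beta> (bernoulli_measure Y ?p)" if sum1: "sum ?p Y = 1"
  proof -
    let ?m = "bernoulli_measure Y ?p"
    have pm: "prob_space ?m" "sets ?m = sets (word_borel Y)"
      using bernoulli_measure_cylinder(1)[OF assms(3) _ sum1] sets_bernoulli_measure[OF assms(3)] by auto
    interpret cuntz_kms G Y V E \<Phi> ?m F \<alpha> \<beta> by (rule setting[OF pm])
    have "kms_state \<A> \<alpha> \<beta> \<omega>"
    proof (rule kms_state_if_cylinders)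
      fix t assume t: "t \<in> lists Y"
      have "emeasure ?m (cylinder Y t) = ennreal (exp (- \<beta> * word_sum F t))"
        using bernoulli_measure_cylinder(2)[OF assms(3) _ sum1 t]
        by (simp only: prod_list_exp_word_sum exp_ge_zero)
      then show "prob (cylinder Y t) = exp (- \<beta> * word_sum F t)"
        by (simp add: measure_def)
    qed
    then show ?thesis
      using pm unfolding kms_measure_def \<omega>_def[abs_def] by blast
  qed
  \<comment> \<open>Fact 1 gives the necessity of the weight condition and determines m; fact 2
    gives existence.\<close>
  show ?thesis using 1 2 by metis
qed

end
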